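(* There is a one-to-one correspondence between $n$-term bihom-$A_\infty$-algebras whose underlying chain complexes are of the form $$A_{n-1}\xrightarrow{0}0\xrightarrow{0}\cdots\xrightarrow{0}0\xrightarrow{0}A_0$$ (that is, nonzero terms are concentrated in degrees $0$ and $n-1$, and the differential is zero) and tuples $((A,m,\alpha,\beta),M,\cdot,\alpha_M,\beta_M,\theta)$, where $(A,m,\alpha,\beta)$ is a bihom-associative algebra, $(M,\cdot,\alpha_M,\beta_M)$ is a bimodule over $A$, and $\theta$ is an $(n+1)$-cocycle of $A$ with coefficients in the bimodule $M$.
   Context: All vector spaces and linear maps are over a field $\mathbb{K}$ of characteristic zero. A bihom-$A_\infty$-algebra $(A,m_k,\alpha,\beta)$ is a graded vector space $A=\bigoplus A_i$ with linear maps $m_k:A^{\otimes k}\to A$ of degree $k-2$ for $1\le k<\infty$, and two commuting linear maps $\alpha,\beta:A\to A$ of degree $0$ with $\alpha\circ m_k=m_k\circ\alpha^{\otimes k}$ and $\beta\circ m_k=m_k\circ\beta^{\otimes k}$ for all $k$, such that for all $N\ge1$ and homogeneous $a_i\in A_{|a_i|}$, $$\sum_{i+j=N+1}\sum_{\lambda=1}^{j}(-1)^{\lambda(i+1)+i(|a_1|+\dots+|a_{\lambda-1}|)}m_j\big(\alpha^{i-1}a_1,\dots,\alpha^{i-1}a_{\lambda-1},m_i(a_\lambda,\dots,a_{\lambda+i-1}),\beta^{i-1}a_{\lambda+i},\dots,\beta^{i-1}a_N\big)=0.$$ The underlying chain complex is $(A,m_1)$. It is $n$-term if $A$ is concentrated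 in degrees $0,\dots,n-1$. A bihom-associative algebra $(A,m,\alpha,\beta)$ is a vector space $A$ with a bilinear map $m:A\times A\to A$ and two commuting linear maps $\alpha,\beta:A\to A$ such that $\alpha(m(a,b))=m(\alpha(a),\alpha(b))$, $\beta(m(a,b))=m(\beta(a),\beta(b))$ and $m(\alpha(a),m(b,c))=m(m(a,b),\beta(c))$. An $A$-bimodule $(M,\cdot,\alpha_M,\beta_M)$ is a vector space $M$ with bilinear actions $a\cdot x$ and $x\cdot a$ ($a\in A$, $x\in M$) and commuting linear maps $\alpha_M,\beta_M:M\to M$ such that $\alpha_M(a\cdot x)=\alpha(a)\cdot\alpha_M(x)$, $\beta_M(a\cdot x)=\beta(a)\cdot\beta_M(x)$, $\alpha_M(x\cdot a)=\alpha_M(x)\cdot\alpha(a)$, $\beta_M(x\cdot a)=\beta_M(x)\cdot\beta(a)$, $\alpha(a)\cdot(b\cdot x)=m(a,b)\cdot\beta_M(x)$, $\alpha_M(x)\cdot m(a,b)=(x\cdot a)\cdot\beta(b)$, $\alpha(a)\cdot(x\cdot b)=(a\cdot x)\cdot\beta(b)$. $k$-cochains of $A$ with coefficients in $M$ are linear maps $f:A^{\otimes k}\to M$ with $\alpha_M\circ f=f\circ\alpha^{\otimes k}$, $\beta_M\circ f=f\circ\beta^{\otimes k}$; the coboundary is $$(\delta_{\mathrm{Hoch}}f)(a_1,\dots,a_{k+1})=\alpha^{k-1}(a_1)\cdot f(a_2,\dots,a_{k+1})+\sum_{i=1}^k(-1)^if(\alpha(a_1),\dots,\alpha(a_{i-1}),m(a_i,a_{i+1}),\beta(a_{i+2}),\dots,\beta(a_{k+1}))+(-1)^{k+1}f(a_1,\dots,a_k)\cdot\beta^{k-1}(a_{k+1}),$$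 and a $k$-cocycle is a $k$-cochain $f$ with $\delta_{\mathrm{Hoch}}f=0$. *)

theory Defs
  imports Complex_Main "HOL-Library.FuncSet" "HOL-Library.Poly_Mapping"
begin

text \<open>
  Vector spaces are subspaces of an ambient vector space given by a scalar multiplication
  \<open>scale\<close>; a structure map on them is a function that is \<^const>\<open>undefined\<close> off its domain, so
  that structures are equal in HOL iff they are equal in the mathematical sense.
  A linear map \<open>V\<^sup>\<otimes>\<^sup>k \<rightarrow> W\<close> is a \<open>k\<close>-linear map on \<open>k\<close>-tuples, which are lists of length \<open>k\<close>.
\<close>

definition tuples :: "nat \<Rightarrow> 'v set \<Rightarrow> 'v list set" where
  "tuples k V = {xs. length xs = k \<and> set xs \<subseteq> V}"

definition linear_maps ::
  "('k \<Rightarrow> 'v \<Rightarrow> 'v) \<Rightarrow> 'v::ab_group_add set \<Rightarrow> 'v set \<Rightarrow> ('v \<Rightarrow> 'v) set" where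
  "linear_maps scale V W = {f \<in> V \<rightarrow>\<^sub>E W.
     (\<forall>x\<in>V. \<forall>y\<in>V. f (x + y) = f x + f y) \<and> (\<forall>c. \<forall>x\<in>V. f (scale c x) = scale c (f x))}"

definition bilinear_maps ::
  "('k \<Rightarrow> 'v \<Rightarrow> 'v) \<Rightarrow> 'v::ab_group_add set \<Rightarrow> 'v set \<Rightarrow> 'v set \<Rightarrow> ('v \<Rightarrow> 'v \<Rightarrow> 'v) set" where
  "bilinear_maps scale U V W = {f \<in> U \<rightarrow>\<^sub>E (V \<rightarrow>\<^sub>E W).
     (\<forall>x\<in>U. \<forall>x'\<in>U. \<forall>y\<in>V. f (x + x') y = f x y + f x' y) \<and>
     (\<forall>x\<in>U. \<forall>y\<in>V. \<forall>y'\<in>V. f x (y + y') = f x y + f x y') \<and>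
     (\<forall>c. \<forall>x\<in>U. \<forall>y\<in>V. f (scale c x) y = scale c (f x y) \<and> f x (scale c y) = scale c (f x y))}"

definition multilinear_maps ::
  "('k \<Rightarrow> 'v \<Rightarrow> 'v) \<Rightarrow> nat \<Rightarrow> 'v::ab_group_add set \<Rightarrow> 'v set \<Rightarrow> ('v list \<Rightarrow> 'v) set" where
  "multilinear_maps scale k V W = {f \<in> tuples k V \<rightarrow>\<^sub>E W.
     \<forall>xs\<in>tuples k V. \<forall>i<k. \<forall>x\<in>V.
       (\<forall>y\<in>V. f (xs[i := x + y]) = f (xs[i := x]) + f (xs[i := y])) \<and>
       (\<forall>c. f (xs[i := scale c x]) = scale c (f (xs[i := x])))}"


section \<open>Graded vector spaces\<close>

text \<open>
  A graded vector space is a family of subspaces \<open>G i\<close> of the ambient space. Its total space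
  is the external direct sum of the \<open>G i\<close>, realized by finitely supported functions.
\<close>

definition gscale :: "('k \<Rightarrow> 'v \<Rightarrow> 'v) \<Rightarrow> 'k \<Rightarrow> (int \<Rightarrow>\<^sub>0 'v::ab_group_add) \<Rightarrow> (int \<Rightarrow>\<^sub>0 'v)" where
  "gscale scale c x = Poly_Mapping.map (scale c) x"

definition total :: "(int \<Rightarrow> 'v::ab_group_add set) \<Rightarrow> (int \<Rightarrow>\<^sub>0 'v) set" where
  "total G = {x. \<forall>i. Poly_Mapping.lookup x i \<in> G i}"

definition homog :: "(int \<Rightarrow> 'v::ab_group_add set) \<Rightarrow> int \<Rightarrow> (int \<Rightarrow>\<^sub>0 'v) set" where
  "homog G d = Poly_Mapping.single d ` G d"

lemma lookup_gscale:
  assumes "vector_space scale"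
  shows "Poly_Mapping.lookup (gscale scale c x) i = scale c (Poly_Mapping.lookup x i)"
proof -
  interpret vector_space scale by fact
  show ?thesis by (simp add: gscale_def map.rep_eq when_def)
qed

lemma vector_space_gscale:
  assumes "vector_space scale"
  shows "vector_space (gscale scale)"
proof -
  interpret vector_space scale by fact
  show ?thesis
    by unfold_locales
      (auto intro!: poly_mapping_eqI
        simp: lookup_gscale[OF assms] lookup_add scale_right_distrib scale_left_distrib)
qed


section \<open>Bihom-associative algebras, bimodules and Hochschild cocycles\<close>

locale bihom_associative_algebra = vector_space scale
  for scale :: "'k::field_char_0 \<Rightarrow> 'v::ab_group_add \<Rightarrow> 'v" +
  fixes A :: "'v set" and m :: "'v \<Rightarrow> 'v \<Rightarrow> 'v" and \<alpha> \<beta> :: "'v \<Rightarrow> 'v"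
  assumes subspace_A: "subspace A"
    and m_bilinear: "m \<in> bilinear_maps scale A A A"
    and \<alpha>_linear: "\<alpha> \<in> linear_maps scale A A"
    and \<beta>_linear: "\<beta> \<in> linear_maps scale A A"
    and \<alpha>_\<beta>: "\<And>a. a \<in> A \<Longrightarrow> \<alpha> (\<beta> a) = \<beta> (\<alpha> a)"
    and \<alpha>_m: "\<And>a b. a \<in> A \<Longrightarrow> b \<in> A \<Longrightarrow> \<alpha> (m a b) = m (\<alpha> a) (\<alpha> b)"
    and \<beta>_m: "\<And>a b. a \<in> A \<Longrightarrow> b \<in> A \<Longrightarrow> \<beta> (m a b) = m (\<beta> a) (\<beta> b)"
    and bihom_assoc:
      "\<And>a b c. a \<in> A \<Longrightarrow> b \<in> A \<Longrightarrow> c \<in> A \<Longrightarrow> m (\<alpha> a) (m b c) = m (m a b) (\<beta> c)"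

text \<open>\<open>lact a x\<close> is \<open>a \<cdot> x\<close> and \<open>ract x a\<close> is \<open>x \<cdot> a\<close>.\<close>

locale bihom_bimodule = bihom_associative_algebra scale A m \<alpha> \<beta>
  for scale :: "'k::field_char_0 \<Rightarrow> 'v::ab_group_add \<Rightarrow> 'v" and A m \<alpha> \<beta> +
  fixes M :: "'v set" and lact ract :: "'v \<Rightarrow> 'v \<Rightarrow> 'v" and \<alpha>\<^sub>M \<beta>\<^sub>M :: "'v \<Rightarrow> 'v"
  assumes subspace_M: "subspace M"
    and lact_bilinear: "lact \<in> bilinear_maps scale A M M"
    and ract_bilinear: "ract \<in> bilinear_maps scale M A M"
    and \<alpha>\<^sub>M_linear: "\<alpha>\<^sub>M \<in> linear_maps scale M M"
    and \<beta>\<^sub>M_linear: "\<beta>\<^sub>M \<in> linear_maps scale M M"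
    and \<alpha>\<^sub>M_\<beta>\<^sub>M: "\<And>x. x \<in> M \<Longrightarrow> \<alpha>\<^sub>M (\<beta>\<^sub>M x) = \<beta>\<^sub>M (\<alpha>\<^sub>M x)"
    and \<alpha>\<^sub>M_lact: "\<And>a x. a \<in> A \<Longrightarrow> x \<in> M \<Longrightarrow> \<alpha>\<^sub>M (lact a x) = lact (\<alpha> a) (\<alpha>\<^sub>M x)"
    and \<beta>\<^sub>M_lact: "\<And>a x. a \<in> A \<Longrightarrow> x \<in> M \<Longrightarrow> \<beta>\<^sub>M (lact a x) = lact (\<beta> a) (\<beta>\<^sub>M x)"
    and \<alpha>\<^sub>M_ract: "\<And>a x. a \<in> A \<Longrightarrow> x \<in> M \<Longrightarrow> \<alpha>\<^sub>M (ract x a) = ract (\<alpha>\<^sub>M x) (\<alpha> a)"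
    and \<beta>\<^sub>M_ract: "\<And>a x. a \<in> A \<Longrightarrow> x \<in> M \<Longrightarrow> \<beta>\<^sub>M (ract x a) = ract (\<beta>\<^sub>M x) (\<beta> a)"
    and lact_lact: "\<And>a b x. a \<in> A \<Longrightarrow> b \<in> A \<Longrightarrow> x \<in> M \<Longrightarrow>
        lact (\<alpha> a) (lact b x) = lact (m a b) (\<beta>\<^sub>M x)"
    and ract_ract: "\<And>a b x. a \<in> A \<Longrightarrow> b \<in> A \<Longrightarrow> x \<in> M \<Longrightarrow>
        ract (\<alpha>\<^sub>M x) (m a b) = ract (ract x a) (\<beta> b)"
    and lact_ract: "\<And>a b x. a \<in> A \<Longrightarrow> b \<in> A \<Longrightarrow> x \<in> M \<Longrightarrow>
        lact (\<alpha> a) (ract x b) = ract (lact a x) (\<beta> b)"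

definition hoch_cochains ::
  "('k \<Rightarrow> 'v::ab_group_add \<Rightarrow> 'v) \<Rightarrow> 'v set \<Rightarrow> ('v \<Rightarrow> 'v) \<Rightarrow> ('v \<Rightarrow> 'v) \<Rightarrow>
   'v set \<Rightarrow> ('v \<Rightarrow> 'v) \<Rightarrow> ('v \<Rightarrow> 'v) \<Rightarrow> nat \<Rightarrow> ('v list \<Rightarrow> 'v) set" where
  "hoch_cochains scale A \<alpha> \<beta> M \<alpha>\<^sub>M \<beta>\<^sub>M k = {f \<in> multilinear_maps scale k A M.
     \<forall>as\<in>tuples k A. \<alpha>\<^sub>M (f as) = f (map \<alpha> as) \<and> \<beta>\<^sub>M (f as) = f (map \<beta> as)}"

text \<open>
  The coboundary of a \<open>k\<close>-cochain \<open>f\<close> (\<open>k \<ge> 1\<close>) at a list of length \<open>k + 1\<close>; list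
  positions start at \<open>0\<close>, so \<open>a\<^sub>i\<close> is \<open>as ! (i - 1)\<close>.
\<close>

definition hoch_coboundary ::
  "('k::field_char_0 \<Rightarrow> 'v::ab_group_add \<Rightarrow> 'v) \<Rightarrow> ('v \<Rightarrow> 'v \<Rightarrow> 'v) \<Rightarrow> ('v \<Rightarrow> 'v) \<Rightarrow> ('v \<Rightarrow> 'v) \<Rightarrow>
   ('v \<Rightarrow> 'v \<Rightarrow> 'v) \<Rightarrow> ('v \<Rightarrow> 'v \<Rightarrow> 'v) \<Rightarrow> nat \<Rightarrow> ('v list \<Rightarrow> 'v) \<Rightarrow> 'v list \<Rightarrow> 'v" where
  "hoch_coboundary scale m \<alpha> \<beta> lact ract k f as =
     lact ((\<alpha> ^^ (k - 1)) (as ! 0)) (f (drop 1 as))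
     + (\<Sum>i=1..k. scale ((-1) ^ i)
          (f (map \<alpha> (take (i - 1) as) @ [m (as ! (i - 1)) (as ! i)] @ map \<beta> (drop (i + 1) as))))
     + scale ((-1) ^ (k + 1)) (ract (f (take k as)) ((\<beta> ^^ (k - 1)) (as ! k)))"

definition hoch_cocycles ::
  "('k::field_char_0 \<Rightarrow> 'v::ab_group_add \<Rightarrow> 'v) \<Rightarrow> 'v set \<Rightarrow> ('v \<Rightarrow> 'v \<Rightarrow> 'v) \<Rightarrow> ('v \<Rightarrow> 'v) \<Rightarrow> ('v \<Rightarrow> 'v) \<Rightarrow>
   'v set \<Rightarrow> ('v \<Rightarrow> 'v \<Rightarrow> 'v) \<Rightarrow> ('v \<Rightarrow> 'v \<Rightarrow> 'v) \<Rightarrow> ('v \<Rightarrow> 'v) \<Rightarrow> ('v \<Rightarrow> 'v) \<Rightarrow> nat \<Rightarrow> ('v list \<Rightarrow> 'v) set" where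
  "hoch_cocycles scale A m \<alpha> \<beta> M lact ract \<alpha>\<^sub>M \<beta>\<^sub>M k =
     {f \<in> hoch_cochains scale A \<alpha> \<beta> M \<alpha>\<^sub>M \<beta>\<^sub>M k.
        \<forall>as\<in>tuples (k + 1) A. hoch_coboundary scale m \<alpha> \<beta> lact ract k f as = 0}"


section \<open>Bihom-A-infinity algebras\<close>

text \<open>
  The left-hand side of the \<open>N\<close>-th identity at homogeneous \<open>as\<close> of degrees \<open>ds\<close>
  (both of length \<open>N\<close>), with \<open>j = N + 1 - i\<close> and \<open>p\<close> for the summation index \<open>\<lambda>\<close>.
\<close>

definition bihom_A_inf_expr ::
  "('k::field_char_0 \<Rightarrow> 'v::ab_group_add \<Rightarrow> 'v) \<Rightarrow> (nat \<Rightarrow> (int \<Rightarrow>\<^sub>0 'v) list \<Rightarrow> (int \<Rightarrow>\<^sub>0 'v)) \<Rightarrow>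
   ((int \<Rightarrow>\<^sub>0 'v) \<Rightarrow> (int \<Rightarrow>\<^sub>0 'v)) \<Rightarrow> ((int \<Rightarrow>\<^sub>0 'v) \<Rightarrow> (int \<Rightarrow>\<^sub>0 'v)) \<Rightarrow>
   nat \<Rightarrow> int list \<Rightarrow> (int \<Rightarrow>\<^sub>0 'v) list \<Rightarrow> (int \<Rightarrow>\<^sub>0 'v)" where
  "bihom_A_inf_expr scale m \<alpha> \<beta> N ds as =
     (\<Sum>i=1..N. \<Sum>p=1..N + 1 - i.
        gscale scale ((-1) powi (int p * (int i + 1) + int i * sum_list (take (p - 1) ds)))
          (m (N + 1 - i)
             (map (\<alpha> ^^ (i - 1)) (take (p - 1) as)
              @ [m i (take i (drop (p - 1) as))]
              @ map (\<beta> ^^ (i - 1)) (drop (p - 1 + i) as))))"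

text \<open>The operations are \<open>m k\<close> for \<open>k \<ge> 1\<close>; \<open>m 0\<close> is \<^const>\<open>undefined\<close>.\<close>

locale bihom_A_inf_algebra = vector_space scale
  for scale :: "'k::field_char_0 \<Rightarrow> 'v::ab_group_add \<Rightarrow> 'v" +
  fixes G :: "int \<Rightarrow> 'v set"
    and m :: "nat \<Rightarrow> (int \<Rightarrow>\<^sub>0 'v) list \<Rightarrow> (int \<Rightarrow>\<^sub>0 'v)"
    and \<alpha> \<beta> :: "(int \<Rightarrow>\<^sub>0 'v) \<Rightarrow> (int \<Rightarrow>\<^sub>0 'v)"
  assumes subspace_G: "\<And>i. subspace (G i)"
    and m_multilinear: "m \<in> (\<Pi>\<^sub>E k\<in>{1..}. multilinear_maps (gscale scale) k (total G) (total G))"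
    and m_degree: "\<And>k ds as. k \<ge> 1 \<Longrightarrow> length ds = k \<Longrightarrow> list_all2 (\<lambda>d a. a \<in> homog G d) ds as \<Longrightarrow>
        m k as \<in> homog G (sum_list ds + int k - 2)"
    and \<alpha>_linear: "\<alpha> \<in> linear_maps (gscale scale) (total G) (total G)"
    and \<beta>_linear: "\<beta> \<in> linear_maps (gscale scale) (total G) (total G)"
    and \<alpha>_degree: "\<And>d a. a \<in> homog G d \<Longrightarrow> \<alpha> a \<in> homog G d"
    and \<beta>_degree: "\<And>d a. a \<in> homog G d \<Longrightarrow> \<beta> a \<in> homog G d"
    and \<alpha>_\<beta>: "\<And>a. a \<in> total G \<Longrightarrow> \<alpha> (\<beta> a) = \<beta> (\<alpha> a)"
    and \<alpha>_m: "\<And>k as. k \<ge> 1 \<Longrightarrow> as \<in> tuples k (total G) \<Longrightarrow> \<alpha> (m k as) = m k (map \<alpha> as)"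
    and \<beta>_m: "\<And>k as. k \<ge> 1 \<Longrightarrow> as \<in> tuples k (total G) \<Longrightarrow> \<beta> (m k as) = m k (map \<beta> as)"
    and bihom_A_inf: "\<And>N ds as. N \<ge> 1 \<Longrightarrow> length ds = N \<Longrightarrow>
        list_all2 (\<lambda>d a. a \<in> homog G d) ds as \<Longrightarrow> bihom_A_inf_expr scale m \<alpha> \<beta> N ds as = 0"

definition n_term :: "nat \<Rightarrow> (int \<Rightarrow> 'v::ab_group_add set) \<Rightarrow> bool" where
  "n_term n G \<longleftrightarrow> (\<forall>i. i \<notin> {0..int n - 1} \<longrightarrow> G i = {0})"

definition two_ended_zero_differential ::
  "nat \<Rightarrow> (int \<Rightarrow> 'v::ab_group_add set) \<Rightarrow> (nat \<Rightarrow> (int \<Rightarrow>\<^sub>0 'v) list \<Rightarrow> (int \<Rightarrow>\<^sub>0 'v)) \<Rightarrow> bool" where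
  "two_ended_zero_differential n G m \<longleftrightarrow>
     (\<forall>i. i \<noteq> 0 \<and> i \<noteq> int n - 1 \<longrightarrow> G i = {0}) \<and> (\<forall>x\<in>total G. m 1 [x] = 0)"


section \<open>The correspondence\<close>

text \<open>
  The tuple of a bihom-A-infinity algebra on \<open>A\<^sub>n\<^sub>-\<^sub>1 \<rightarrow> 0 \<rightarrow> \<dots> \<rightarrow> 0 \<rightarrow> A\<^sub>0\<close>:
  \<open>A = A\<^sub>0\<close>, \<open>M = A\<^sub>n\<^sub>-\<^sub>1\<close>, the product and the actions are the components of \<open>m 2\<close>, the cocycle is
  the restriction of \<open>m (n + 1)\<close> to degree \<open>0\<close>, and the structure maps are restrictions.
\<close>

fun associated_tuple ::
  "nat \<Rightarrow> (int \<Rightarrow> 'v::ab_group_add set) \<times> (nat \<Rightarrow> (int \<Rightarrow>\<^sub>0 'v) list \<Rightarrow> (int \<Rightarrow>\<^sub>0 'v)) \<times>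
     ((int \<Rightarrow>\<^sub>0 'v) \<Rightarrow> (int \<Rightarrow>\<^sub>0 'v)) \<times> ((int \<Rightarrow>\<^sub>0 'v) \<Rightarrow> (int \<Rightarrow>\<^sub>0 'v)) \<Rightarrow>
   ('v set \<times> ('v \<Rightarrow> 'v \<Rightarrow> 'v) \<times> ('v \<Rightarrow> 'v) \<times> ('v \<Rightarrow> 'v)) \<times>
   ('v set \<times> ('v \<Rightarrow> 'v \<Rightarrow> 'v) \<times> ('v \<Rightarrow> 'v \<Rightarrow> 'v) \<times> ('v \<Rightarrow> 'v) \<times> ('v \<Rightarrow> 'v)) \<times>
   ('v list \<Rightarrow> 'v)" where
  "associated_tuple n (G, m, \<alpha>, \<beta>) =
    (let t = int n - 1; e = Poly_Mapping.single; c = (\<lambda>d x. Poly_Mapping.lookup x d) in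
     ((G 0,
       (\<lambda>a\<in>G 0. \<lambda>b\<in>G 0. c 0 (m 2 [e 0 a, e 0 b])),
       (\<lambda>a\<in>G 0. c 0 (\<alpha> (e 0 a))),
       (\<lambda>a\<in>G 0. c 0 (\<beta> (e 0 a)))),
      (G t,
       (\<lambda>a\<in>G 0. \<lambda>x\<in>G t. c t (m 2 [e 0 a, e t x])),
       (\<lambda>x\<in>G t. \<lambda>a\<in>G 0. c t (m 2 [e t x, e 0 a])),
       (\<lambda>x\<in>G t. c t (\<alpha> (e t x))),
       (\<lambda>x\<in>G t. c t (\<beta> (e t x)))),
      (\<lambda>as\<in>tuples (n + 1) (G 0). c t (m (n + 1) (map (e 0) as)))))"

end

theory Submission
  imports Defs
begin

text \<open>
  Let \<open>t = n - 1 \<ge> 1\<close>, and let the algebra be concentrated in degrees \<open>0\<close> and \<open>t\<close>, with pieces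
  \<open>A\<close> and \<open>M\<close>. The operation of arity \<open>k\<close> has degree \<open>k - 2\<close>, so on \<open>k\<close> arguments of which \<open>r\<close> lie
  in \<open>M\<close> it takes values in degree \<open>r t + k - 2\<close>. For \<open>k \<ge> 2\<close> this is \<open>0\<close> or \<open>t\<close> only if \<open>k = 2\<close> and
  \<open>r \<le> 1\<close>, or \<open>k = n + 1\<close> and \<open>r = 0\<close>; the differential vanishes by assumption. So the operations
  amount to a product \<open>A \<times> A \<rightarrow> A\<close>, two actions on \<open>M\<close> and a map \<open>\<theta>\<close> of arity \<open>n + 1\<close> from \<open>A\<close> to
  \<open>M\<close>, and any such multilinear maps can be glued to graded operations.

  In the \<open>N\<close>-th identity the inner and the outer operation must both have arity \<open>2\<close> or \<open>n + 1\<close>, and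
  not both \<open>n + 1\<close>, as \<open>\<theta>\<close> takes values in \<open>M\<close> and arguments in \<open>A\<close>. There remain \<open>N = 3\<close>, which says
  that the product of arity \<open>2\<close> is bihom-associative on \<open>A \<oplus> M\<close>, that is, that \<open>A\<close> is
  bihom-associative and \<open>M\<close> is a bimodule, and \<open>N = n + 2\<close>, whose left-hand side is the Hochschild
  coboundary of \<open>\<theta>\<close>, signs included. Compatibility with \<open>\<alpha>\<close> and \<open>\<beta>\<close> likewise splits into the conditions
  on the product, the two actions and \<open>\<theta>\<close>.

  The proof separates the linear data from the equations. The locale \<open>gluing_data\<close> contains only the
  linear data; \<open>gluing_data.associated_glued\<close> and \<open>two_ended_algebra.glue_associated\<close> say
  that gluing and taking components are mutually inverse at this level, and
  \<open>gluing_data.glued_iff\<close> says that the equations on both sides are equivalent. This equivalence,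
  used in both directions, gives the bijection.
\<close>

section \<open>Multilinear maps\<close>

lemma tuples_nth: "xs \<in> tuples k V \<Longrightarrow> i < k \<Longrightarrow> xs ! i \<in> V"
  by (auto simp: tuples_def)

lemma tuples_length: "xs \<in> tuples k V \<Longrightarrow> length xs = k"
  by (simp add: tuples_def)

lemma tuples_update: "xs \<in> tuples k V \<Longrightarrow> x \<in> V \<Longrightarrow> xs[i := x] \<in> tuples k V"
  using set_update_subset_insert[of xs i x] by (auto simp: tuples_def)

lemma tuples_map: "xs \<in> tuples k V \<Longrightarrow> (\<And>x. x \<in> V \<Longrightarrow> f x \<in> W) \<Longrightarrow> map f xs \<in> tuples k W"
  by (auto simp: tuples_def)

lemma tuples_2E:
  assumes "xs \<in> tuples 2 V"
  obtains x y where "xs = [x, y]" "x \<in> V" "y \<in> V"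
  using assms by (auto simp: tuples_def length_Suc_conv numeral_2_eq_2)

lemma tuples_3E:
  assumes "xs \<in> tuples 3 V"
  obtains x y z where "xs = [x, y, z]" "x \<in> V" "y \<in> V" "z \<in> V"
  using assms by (auto simp: tuples_def length_Suc_conv numeral_3_eq_3)

lemma multilinear_closed: "f \<in> multilinear_maps scale k V W \<Longrightarrow> xs \<in> tuples k V \<Longrightarrow> f xs \<in> W"
  by (auto simp: multilinear_maps_def)

lemma multilinear_add:
  "f \<in> multilinear_maps scale k V W \<Longrightarrow> xs \<in> tuples k V \<Longrightarrow> i < k \<Longrightarrow> x \<in> V \<Longrightarrow> y \<in> V \<Longrightarrow>
   f (xs[i := x + y]) = f (xs[i := x]) + f (xs[i := y])"
  by (auto simp: multilinear_maps_def)

lemma multilinear_scale: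
  "f \<in> multilinear_maps scale k V W \<Longrightarrow> xs \<in> tuples k V \<Longrightarrow> i < k \<Longrightarrow> x \<in> V \<Longrightarrow>
   f (xs[i := scale c x]) = scale c (f (xs[i := x]))"
  by (auto simp: multilinear_maps_def)

lemma multilinear_zero:
  assumes "vector_space scale" "f \<in> multilinear_maps scale k V W" "xs \<in> tuples k V" "i < k"
    and "xs ! i = 0"
  shows "f xs = 0"
proof -
  interpret vector_space scale by fact
  have "f (xs[i := scale 0 0]) = scale 0 (f (xs[i := 0]))"
    using multilinear_scale[OF assms(2-4), of 0] tuples_nth[OF assms(3,4)] assms(5) by simp
  moreover have "xs[i := 0] = xs"
    using assms(5) list_update_id[of xs i] by simp
  ultimately show ?thesis by simp
qed

lemma linear_closed: "f \<in> linear_maps scale V W \<Longrightarrow> x \<in> V \<Longrightarrow> f x \<in> W"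
  by (auto simp: linear_maps_def)

lemma linear_add:
  "f \<in> linear_maps scale V W \<Longrightarrow> x \<in> V \<Longrightarrow> y \<in> V \<Longrightarrow> f (x + y) = f x + f y"
  by (auto simp: linear_maps_def)

lemma linear_scale: "f \<in> linear_maps scale V W \<Longrightarrow> x \<in> V \<Longrightarrow> f (scale c x) = scale c (f x)"
  by (auto simp: linear_maps_def)

lemma linear_zero:
  assumes "vector_space scale" "f \<in> linear_maps scale V W" "0 \<in> V"
  shows "f 0 = 0"
proof -
  interpret vector_space scale by fact
  show ?thesis using linear_scale[OF assms(2,3), of 0] by simp
qed

lemma bilinear_closed:
  "f \<in> bilinear_maps scale U V W \<Longrightarrow> x \<in> U \<Longrightarrow> y \<in> V \<Longrightarrow> f x y \<in> W"
  by (auto simp: bilinear_maps_def PiE_def Pi_def)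

lemma bilinear_add_left:
  "f \<in> bilinear_maps scale U V W \<Longrightarrow> x \<in> U \<Longrightarrow> x' \<in> U \<Longrightarrow> y \<in> V \<Longrightarrow> f (x + x') y = f x y + f x' y"
  by (auto simp: bilinear_maps_def)

lemma bilinear_add_right:
  "f \<in> bilinear_maps scale U V W \<Longrightarrow> x \<in> U \<Longrightarrow> y \<in> V \<Longrightarrow> y' \<in> V \<Longrightarrow> f x (y + y') = f x y + f x y'"
  by (auto simp: bilinear_maps_def)

lemma bilinear_scale_left:
  "f \<in> bilinear_maps scale U V W \<Longrightarrow> x \<in> U \<Longrightarrow> y \<in> V \<Longrightarrow> f (scale c x) y = scale c (f x y)"
  by (auto simp: bilinear_maps_def)

lemma bilinear_scale_right:
  "f \<in> bilinear_maps scale U V W \<Longrightarrow> x \<in> U \<Longrightarrow> y \<in> V \<Longrightarrow> f x (scale c y) = scale c (f x y)"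
  by (auto simp: bilinear_maps_def)

lemma bilinear_zero_left:
  assumes "vector_space scale" "f \<in> bilinear_maps scale U V W" "0 \<in> U" "y \<in> V"
  shows "f 0 y = 0"
proof -
  interpret vector_space scale by fact
  show ?thesis using bilinear_scale_left[OF assms(2-4), of 0] by simp
qed

lemma bilinear_zero_right:
  assumes "vector_space scale" "f \<in> bilinear_maps scale U V W" "x \<in> U" "0 \<in> V"
  shows "f x 0 = 0"
proof -
  interpret vector_space scale by fact
  show ?thesis using bilinear_scale_right[OF assms(2-4), of 0] by simp
qed

lemma multilinear_2I:
  assumes ext: "f \<in> extensional (tuples 2 V)"
    and closed: "\<And>x y. x \<in> V \<Longrightarrow> y \<in> V \<Longrightarrow> f [x, y] \<in> W"
    and "\<And>x x' y. x \<in> V \<Longrightarrow> x' \<in> V \<Longrightarrow> y \<in> V \<Longrightarrow> f [x + x', y] = f [x, y] + f [x', y]"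
    and "\<And>x y y'. x \<in> V \<Longrightarrow> y \<in> V \<Longrightarrow> y' \<in> V \<Longrightarrow> f [x, y + y'] = f [x, y] + f [x, y']"
    and "\<And>c x y. x \<in> V \<Longrightarrow> y \<in> V \<Longrightarrow> f [scale c x, y] = scale c (f [x, y])"
    and "\<And>c x y. x \<in> V \<Longrightarrow> y \<in> V \<Longrightarrow> f [x, scale c y] = scale c (f [x, y])"
  shows "f \<in> multilinear_maps scale 2 V W"
proof -
  have "f \<in> tuples 2 V \<rightarrow>\<^sub>E W"
    using ext closed by (auto simp: PiE_def elim!: tuples_2E)
  moreover have "\<forall>x\<in>V. (\<forall>y\<in>V. f (xs[i := x + y]) = f (xs[i := x]) + f (xs[i := y])) \<and>
       (\<forall>c. f (xs[i := scale c x]) = scale c (f (xs[i := x])))" 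
    if "xs \<in> tuples 2 V" "i < 2" for xs i
    using that assms(3-6) by (auto elim!: tuples_2E simp: less_2_cases_iff)
  ultimately show ?thesis by (auto simp: multilinear_maps_def)
qed

section \<open>Graded vector spaces\<close>

lemma total_component: "x \<in> total G \<Longrightarrow> Poly_Mapping.lookup x i \<in> G i"
  by (simp add: total_def)

lemma gscale_single:
  assumes "vector_space scale"
  shows "gscale scale c (Poly_Mapping.single d v) = Poly_Mapping.single d (scale c v)"
proof -
  interpret vector_space scale by fact
  show ?thesis
    by (rule poly_mapping_eqI) (simp add: lookup_gscale[OF assms] lookup_single when_def)
qed

lemma subspace_total:
  assumes "vector_space scale" "\<And>i. module.subspace scale (G i)"
  shows "module.subspace (gscale scale) (total G)"
proof -
  interpret vector_space scale by fact
  interpret g: vector_space "gscale scale" by (rule vector_space_gscale) fact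
  show ?thesis
    using assms(2)
    by (auto simp: g.subspace_def subspace_def total_def lookup_add lookup_gscale[OF assms(1)])
qed

lemma single_in_total:
  assumes "\<And>i. 0 \<in> G i" "v \<in> G d"
  shows "Poly_Mapping.single d v \<in> total G"
  using assms by (auto simp: total_def lookup_single when_def)

lemma homog_iff:
  assumes "\<And>i. 0 \<in> G i"
  shows "x \<in> homog G d \<longleftrightarrow> x \<in> total G \<and> (\<forall>i. i \<noteq> d \<longrightarrow> Poly_Mapping.lookup x i = 0)"
proof
  assume "x \<in> homog G d"
  then show "x \<in> total G \<and> (\<forall>i. i \<noteq> d \<longrightarrow> Poly_Mapping.lookup x i = 0)"
    using assms by (auto simp: homog_def total_def lookup_single when_def)
next
  assume *: "x \<in> total G \<and> (\<forall>i. i \<noteq> d \<longrightarrow> Poly_Mapping.lookup x i = 0)"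
  then have "x = Poly_Mapping.single d (Poly_Mapping.lookup x d)"
    by (intro poly_mapping_eqI) (auto simp: lookup_single when_def)
  with * show "x \<in> homog G d"
    by (auto simp: homog_def total_def)
qed

lemma homog_trivial: "G d = {0} \<Longrightarrow> x \<in> homog G d \<Longrightarrow> x = 0"
  by (auto simp: homog_def)

lemma sum_list_eq_zeroI: "\<forall>d\<in>set ds. d = 0 \<Longrightarrow> sum_list ds = (0 :: int)"
  by (induction ds) auto

lemma sum_list_two_values:
  fixes t :: int
  assumes "set ds \<subseteq> {0, t}" "t \<ge> 0"
  shows "sum_list ds \<ge> 0" "t \<in> set ds \<Longrightarrow> sum_list ds \<ge> t"
proof -
  have "sum_list ds \<ge> 0 \<and> (t \<in> set ds \<longrightarrow> sum_list ds \<ge> t)"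
    using assms by (induction ds) auto
  then show "sum_list ds \<ge> 0" "t \<in> set ds \<Longrightarrow> sum_list ds \<ge> t" by auto
qed

lemma list_all2_homog_tuples:
  assumes "\<And>i. 0 \<in> G i" "list_all2 (\<lambda>d a. a \<in> homog G d) ds as" "length ds = k"
  shows "as \<in> tuples k (total G)"
  using assms homog_iff[of G]
  by (fastforce simp: tuples_def list_all2_conv_all_nth in_set_conv_nth)

text \<open>
  A multilinear map on a direct sum of two graded pieces is determined by its values on lists
  of homogeneous elements: the entries of a list are split into their two components one after
  another, the induction being over the number of entries that are not yet split.
\<close>

lemma multilinear_eq_on_homog:
  assumes f: "f \<in> multilinear_maps S k (total G) W" and g: "g \<in> multilinear_maps S k (total G) W"
    and zero: "\<And>i. 0 \<in> G i"
    and conc: "\<And>i. i \<noteq> d \<Longrightarrow> i \<noteq> e \<Longrightarrow> G i = {0}" and "d \<noteq> e"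
    and eq: "\<And>ds xs. length ds = k \<Longrightarrow> set ds \<subseteq> {d, e} \<Longrightarrow>
      list_all2 (\<lambda>d a. a \<in> homog G d) ds xs \<Longrightarrow> f xs = g xs"
    and xs: "xs \<in> tuples k (total G)"
  shows "f xs = g xs"
proof -
  have "f xs = g xs" if "j \<le> k" "xs \<in> tuples k (total G)"
    "\<forall>i<k. j \<le> i \<longrightarrow> xs ! i \<in> homog G d \<union> homog G e" for j xs
    using that
  proof (induction j arbitrary: xs)
    case 0
    define ds where "ds = map (\<lambda>x. if x \<in> homog G d then d else e) xs"
    have len: "length xs = k" using 0 by (simp add: tuples_def)
    show ?case
    proof (rule eq)
      show "list_all2 (\<lambda>d a. a \<in> homog G d) ds xs"
        using 0 len by (auto simp: ds_def list_all2_conv_all_nth)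
    qed (auto simp: ds_def len)
  next
    case (Suc j)
    let ?s = "\<lambda>d. Poly_Mapping.single d (Poly_Mapping.lookup (xs ! j) d)"
    have j: "j < k" and len: "length xs = k" using Suc.prems by (auto simp: tuples_def)
    have x: "xs ! j \<in> total G" using tuples_nth[OF Suc.prems(2) j] .
    have s: "?s c \<in> total G" "?s c \<in> homog G c" for c
      using single_in_total[of G, OF zero total_component[OF x]] total_component[OF x]
      by (auto simp: homog_def)
    have "xs ! j = ?s d + ?s e"
      using \<open>d \<noteq> e\<close> total_component[OF x] conc
      by (intro poly_mapping_eqI) (force simp: lookup_add lookup_single when_def)
    then have xs: "xs = xs[j := ?s d + ?s e]" using list_update_id[of xs j] by simp
    have "f (xs[j := ?s c]) = g (xs[j := ?s c])" if "c \<in> {d, e}" for c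
    proof (rule Suc.IH)
      show "xs[j := ?s c] \<in> tuples k (total G)" by (intro tuples_update Suc.prems s)
      show "\<forall>i<k. j \<le> i \<longrightarrow> xs[j := ?s c] ! i \<in> homog G d \<union> homog G e"
      proof (intro allI impI)
        fix i assume i: "i < k" "j \<le> i"
        show "xs[j := ?s c] ! i \<in> homog G d \<union> homog G e"
        proof (cases "i = j")
          case True
          then show ?thesis using s(2)[of c] that j len by auto
        next
          case False
          then show ?thesis using Suc.prems(3) i by auto
        qed
      qed
    qed (use j in simp)
    then have "f (xs[j := ?s d + ?s e]) = g (xs[j := ?s d + ?s e])"
      using multilinear_add[OF f Suc.prems(2) j s(1) s(1)]
        multilinear_add[OF g Suc.prems(2) j s(1) s(1)] by simp
    then show ?case using xs by metis
  qed
  from this[of k xs] show ?thesis using xs by simp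
qed

section \<open>Gluing an algebra, a bimodule and a cochain\<close>

definition two_ended_space :: "nat \<Rightarrow> 'v set \<Rightarrow> 'v set \<Rightarrow> int \<Rightarrow> 'v::ab_group_add set" where
  "two_ended_space n A M = (\<lambda>i. if i = 0 then A else if i = int n - 1 then M else {0})"

text \<open>
  The glued maps and operations are \<^const>\<open>undefined\<close> off their domains, so that taking
  components and gluing again gives back the same functions and not only functions that agree on
  the total space.
\<close>

definition glued_map ::
  "nat \<Rightarrow> 'v::ab_group_add set \<Rightarrow> 'v set \<Rightarrow> ('v \<Rightarrow> 'v) \<Rightarrow> ('v \<Rightarrow> 'v) \<Rightarrow> (int \<Rightarrow>\<^sub>0 'v) \<Rightarrow> (int \<Rightarrow>\<^sub>0 'v)" where
  "glued_map n A M \<alpha> \<alpha>\<^sub>M = (\<lambda>x\<in>total (two_ended_space n A M).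
     Poly_Mapping.single 0 (\<alpha> (Poly_Mapping.lookup x 0))
     + Poly_Mapping.single (int n - 1) (\<alpha>\<^sub>M (Poly_Mapping.lookup x (int n - 1))))"

definition glued_ops ::
  "nat \<Rightarrow> 'v::ab_group_add set \<Rightarrow> 'v set \<Rightarrow> ('v \<Rightarrow> 'v \<Rightarrow> 'v) \<Rightarrow> ('v \<Rightarrow> 'v \<Rightarrow> 'v) \<Rightarrow> ('v \<Rightarrow> 'v \<Rightarrow> 'v) \<Rightarrow>
   ('v list \<Rightarrow> 'v) \<Rightarrow> nat \<Rightarrow> (int \<Rightarrow>\<^sub>0 'v) list \<Rightarrow> (int \<Rightarrow>\<^sub>0 'v)" where
  "glued_ops n A M m lact ract \<theta> =
    (let t = int n - 1; e = Poly_Mapping.single; c = (\<lambda>d x. Poly_Mapping.lookup x d) in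
     (\<lambda>k\<in>{1..}. \<lambda>xs\<in>tuples k (total (two_ended_space n A M)).
       if k = 2 then
         e 0 (m (c 0 (xs ! 0)) (c 0 (xs ! 1)))
         + e t (lact (c 0 (xs ! 0)) (c t (xs ! 1)) + ract (c t (xs ! 0)) (c 0 (xs ! 1)))
       else if k = n + 1 then e t (\<theta> (map (c 0) xs))
       else 0))"

text \<open>
  The linear data of a tuple, without associativity, the bimodule laws, compatibility of the
  structure maps and the cocycle condition. The glued operations make sense at this
  level, and each missing equation can then be compared with its graded counterpart.
\<close>

locale gluing_data = vector_space scale
  for scale :: "'k::field_char_0 \<Rightarrow> 'v::ab_group_add \<Rightarrow> 'v" +
  fixes n :: nat
    and A :: "'v set" and m :: "'v \<Rightarrow> 'v \<Rightarrow> 'v" and \<alpha> \<beta> :: "'v \<Rightarrow> 'v"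
    and M :: "'v set" and lact ract :: "'v \<Rightarrow> 'v \<Rightarrow> 'v" and \<alpha>\<^sub>M \<beta>\<^sub>M :: "'v \<Rightarrow> 'v"
    and \<theta> :: "'v list \<Rightarrow> 'v"
  assumes n_ge_2: "n \<ge> 2"
    and subspace_A: "subspace A" and subspace_M: "subspace M"
    and m_bilinear: "m \<in> bilinear_maps scale A A A"
    and lact_bilinear: "lact \<in> bilinear_maps scale A M M"
    and ract_bilinear: "ract \<in> bilinear_maps scale M A M"
    and \<alpha>_linear: "\<alpha> \<in> linear_maps scale A A"
    and \<beta>_linear: "\<beta> \<in> linear_maps scale A A"
    and \<alpha>\<^sub>M_linear: "\<alpha>\<^sub>M \<in> linear_maps scale M M"
    and \<beta>\<^sub>M_linear: "\<beta>\<^sub>M \<in> linear_maps scale M M"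
    and \<theta>_multilinear: "\<theta> \<in> multilinear_maps scale (n + 1) A M"
begin

abbreviation "t \<equiv> int n - 1"
abbreviation "G \<equiv> two_ended_space n A M"
abbreviation "T \<equiv> total (two_ended_space n A M)"
abbreviation "\<mu> \<equiv> glued_ops n A M m lact ract \<theta>"
abbreviation "\<alpha>' \<equiv> glued_map n A M \<alpha> \<alpha>\<^sub>M"
abbreviation "\<beta>' \<equiv> glued_map n A M \<beta> \<beta>\<^sub>M"
abbreviation "e \<equiv> Poly_Mapping.single :: int \<Rightarrow> 'v \<Rightarrow> _"
abbreviation "c \<equiv> \<lambda>d (x :: int \<Rightarrow>\<^sub>0 'v). Poly_Mapping.lookup x d"

sublocale g: vector_space "gscale scale"
  by (rule vector_space_gscale) unfold_locales

lemma vs: "vector_space scale"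
  by unfold_locales

lemma t_pos: "t > 0" "t \<noteq> 0" "0 \<noteq> t"
  using n_ge_2 by auto

lemma A_zero: "0 \<in> A" and M_zero: "0 \<in> M"
  using subspace_0 subspace_A subspace_M by auto

lemma G_simps: "G 0 = A" "G t = M" "i \<noteq> 0 \<Longrightarrow> i \<noteq> t \<Longrightarrow> G i = {0}"
  using t_pos by (auto simp: two_ended_space_def)

lemma subspace_G: "subspace (G i)"
  using subspace_A subspace_M subspace_single_0 by (auto simp: two_ended_space_def)

lemma G_zero: "0 \<in> G i"
  using subspace_0[OF subspace_G] .

lemma subspace_T: "g.subspace T"
  by (intro subspace_total vs subspace_G)

lemma T_iff: "x \<in> T \<longleftrightarrow> c 0 x \<in> A \<and> c t x \<in> M \<and> (\<forall>i. i \<noteq> 0 \<longrightarrow> i \<noteq> t \<longrightarrow> c i x = 0)"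
  using t_pos by (force simp: total_def two_ended_space_def)

lemma T_components: "x \<in> T \<Longrightarrow> c 0 x \<in> A" "x \<in> T \<Longrightarrow> c t x \<in> M"
  by (auto simp: T_iff)

lemma T_eqI: "x \<in> T \<Longrightarrow> y \<in> T \<Longrightarrow> c 0 x = c 0 y \<Longrightarrow> c t x = c t y \<Longrightarrow> x = y"
  by (rule poly_mapping_eqI) (metis T_iff)

lemma T_0: "0 \<in> T"
  using g.subspace_0[OF subspace_T] .

lemma single_T: "a \<in> A \<Longrightarrow> e 0 a \<in> T" "x \<in> M \<Longrightarrow> e t x \<in> T"
  using single_in_total[of G, OF G_zero] G_simps by auto

lemma single_homog: "a \<in> A \<Longrightarrow> e 0 a \<in> homog G 0" "x \<in> M \<Longrightarrow> e t x \<in> homog G t"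
  using G_simps by (auto simp: homog_def)

lemma components_single:
  "c 0 (e 0 a) = a" "c t (e t a) = a" "c t (e 0 a) = 0" "c 0 (e t a) = 0"
  using t_pos by (auto simp: lookup_single when_def)

lemma components_sum:
  "c 0 (e 0 a + e t x) = a" "c t (e 0 a + e t x) = x"
  using t_pos by (auto simp: lookup_single when_def lookup_add)

lemma sum_T: "a \<in> A \<Longrightarrow> x \<in> M \<Longrightarrow> e 0 a + e t x \<in> T"
  using g.subspace_add[OF subspace_T] single_T by auto

lemma homog_G_iff: "x \<in> homog G d \<longleftrightarrow> x \<in> T \<and> (d \<noteq> 0 \<longrightarrow> c 0 x = 0) \<and> (d \<noteq> t \<longrightarrow> c t x = 0)"
  by (subst homog_iff[of G, OF G_zero]) (metis T_iff)

lemmas lookup_simps = lookup_add lookup_gscale[OF vs]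

subsection \<open>Structure maps\<close>

lemma map_zero: "\<alpha> 0 = 0" "\<beta> 0 = 0" "\<alpha>\<^sub>M 0 = 0" "\<beta>\<^sub>M 0 = 0"
  using linear_zero[OF vs \<alpha>_linear A_zero] linear_zero[OF vs \<beta>_linear A_zero]
    linear_zero[OF vs \<alpha>\<^sub>M_linear M_zero] linear_zero[OF vs \<beta>\<^sub>M_linear M_zero] .

lemma glued_map_components:
  assumes "x \<in> T"
  shows "c 0 (glued_map n A M f g x) = f (c 0 x)" "c t (glued_map n A M f g x) = g (c t x)"
  using assms by (simp_all add: glued_map_def components_sum)

lemma glued_map_closed:
  assumes "f \<in> linear_maps scale A A" "g \<in> linear_maps scale M M" "x \<in> T"
  shows "glued_map n A M f g x \<in> T"
  using sum_T linear_closed[OF assms(1)] linear_closed[OF assms(2)] T_components[OF assms(3)] assms(3)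
  by (simp add: glued_map_def)

lemma glued_map_linear:
  assumes f: "f \<in> linear_maps scale A A" and g: "g \<in> linear_maps scale M M"
  shows "glued_map n A M f g \<in> linear_maps (gscale scale) T T"
proof -
  note closed = glued_map_closed[OF f g] and comp = glued_map_components
  note sub = g.subspace_add[OF subspace_T] g.subspace_scale[OF subspace_T]
  have "glued_map n A M f g (x + y) = glued_map n A M f g x + glued_map n A M f g y"
    if "x \<in> T" "y \<in> T" for x y
    by (rule T_eqI)
      (use that in \<open>simp_all add: sub closed comp lookup_simps T_components linear_add[OF f] linear_add[OF g]\<close>)
  moreover have "glued_map n A M f g (gscale scale a x) = gscale scale a (glued_map n A M f g x)"
    if "x \<in> T" for a x
    by (rule T_eqI)
      (use that in \<open>simp_all add: sub closed comp lookup_simps T_components linear_scale[OF f] linear_scale[OF g]\<close>)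
  moreover have "glued_map n A M f g \<in> T \<rightarrow>\<^sub>E T"
    using closed by (auto simp: PiE_def) (simp add: glued_map_def)
  ultimately show ?thesis by (auto simp: linear_maps_def)
qed

lemma glued_map_homog:
  assumes f: "f \<in> linear_maps scale A A" and g: "g \<in> linear_maps scale M M"
    and x: "x \<in> homog G d"
  shows "glued_map n A M f g x \<in> homog G d"
  using x glued_map_closed[OF f g] linear_zero[OF vs f A_zero] linear_zero[OF vs g M_zero]
  by (auto simp: homog_G_iff glued_map_components)

lemma glued_map_funpow:
  assumes f: "f \<in> linear_maps scale A A" and g: "g \<in> linear_maps scale M M" and x: "x \<in> T"
  shows "(glued_map n A M f g ^^ k) x \<in> T"
    and "c 0 ((glued_map n A M f g ^^ k) x) = (f ^^ k) (c 0 x)"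
    and "c t ((glued_map n A M f g ^^ k) x) = (g ^^ k) (c t x)"
proof -
  have "(glued_map n A M f g ^^ k) x \<in> T \<and> c 0 ((glued_map n A M f g ^^ k) x) = (f ^^ k) (c 0 x)
    \<and> c t ((glued_map n A M f g ^^ k) x) = (g ^^ k) (c t x)"
    by (induction k) (auto simp: x glued_map_closed[OF f g] glued_map_components)
  then show "(glued_map n A M f g ^^ k) x \<in> T"
    "c 0 ((glued_map n A M f g ^^ k) x) = (f ^^ k) (c 0 x)"
    "c t ((glued_map n A M f g ^^ k) x) = (g ^^ k) (c t x)" by auto
qed

subsection \<open>Operations\<close>

lemmas op_closed = bilinear_closed[OF m_bilinear] bilinear_closed[OF lact_bilinear]
  bilinear_closed[OF ract_bilinear]

lemma op_zero:
  "a \<in> A \<Longrightarrow> m 0 a = 0" "a \<in> A \<Longrightarrow> m a 0 = 0"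
  "x \<in> M \<Longrightarrow> lact 0 x = 0" "a \<in> A \<Longrightarrow> lact a 0 = 0"
  "a \<in> A \<Longrightarrow> ract 0 a = 0" "x \<in> M \<Longrightarrow> ract x 0 = 0"
  using bilinear_zero_left[OF vs] bilinear_zero_right[OF vs] A_zero M_zero
    m_bilinear lact_bilinear ract_bilinear by metis+

lemmas op_add = bilinear_add_left[OF m_bilinear] bilinear_add_right[OF m_bilinear]
  bilinear_add_left[OF lact_bilinear] bilinear_add_right[OF lact_bilinear]
  bilinear_add_left[OF ract_bilinear] bilinear_add_right[OF ract_bilinear]

lemmas op_scale = bilinear_scale_left[OF m_bilinear] bilinear_scale_right[OF m_bilinear]
  bilinear_scale_left[OF lact_bilinear] bilinear_scale_right[OF lact_bilinear]
  bilinear_scale_left[OF ract_bilinear] bilinear_scale_right[OF ract_bilinear]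

lemma M_add: "x \<in> M \<Longrightarrow> y \<in> M \<Longrightarrow> x + y \<in> M"
  using subspace_add[OF subspace_M] .

lemma \<mu>_2:
  assumes "x \<in> T" "y \<in> T"
  shows "\<mu> 2 [x, y] \<in> T"
    and "c 0 (\<mu> 2 [x, y]) = m (c 0 x) (c 0 y)"
    and "c t (\<mu> 2 [x, y]) = lact (c 0 x) (c t y) + ract (c t x) (c 0 y)"
proof -
  have "[x, y] \<in> tuples 2 T" using assms by (simp add: tuples_def)
  then have "\<mu> 2 [x, y] = e 0 (m (c 0 x) (c 0 y)) + e t (lact (c 0 x) (c t y) + ract (c t x) (c 0 y))"
    by (simp add: glued_ops_def Let_def)
  then show "\<mu> 2 [x, y] \<in> T" "c 0 (\<mu> 2 [x, y]) = m (c 0 x) (c 0 y)"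
    "c t (\<mu> 2 [x, y]) = lact (c 0 x) (c t y) + ract (c t x) (c 0 y)"
    using assms by (auto simp: components_sum op_closed T_components intro!: sum_T M_add)
qed

lemma \<mu>_top: "xs \<in> tuples (n + 1) T \<Longrightarrow> \<mu> (n + 1) xs = e t (\<theta> (map (c 0) xs))"
  using n_ge_2 by (simp add: glued_ops_def Let_def)

lemma \<mu>_other: "k \<ge> 1 \<Longrightarrow> k \<noteq> 2 \<Longrightarrow> k \<noteq> n + 1 \<Longrightarrow> xs \<in> tuples k T \<Longrightarrow> \<mu> k xs = 0"
  by (simp add: glued_ops_def Let_def)

lemma map_component_tuples: "xs \<in> tuples k T \<Longrightarrow> map (c 0) xs \<in> tuples k A"
  by (auto intro: tuples_map T_components)

lemma \<theta>_closed: "as \<in> tuples (n + 1) A \<Longrightarrow> \<theta> as \<in> M"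
  by (rule multilinear_closed[OF \<theta>_multilinear])

lemma \<theta>_zero: "as \<in> tuples (n + 1) A \<Longrightarrow> i < n + 1 \<Longrightarrow> as ! i = 0 \<Longrightarrow> \<theta> as = 0"
  by (rule multilinear_zero[OF vs \<theta>_multilinear])

lemma \<mu>_top_closed: "xs \<in> tuples (n + 1) T \<Longrightarrow> \<mu> (n + 1) xs \<in> T"
  by (simp only: \<mu>_top) (intro single_T \<theta>_closed map_component_tuples)

lemma \<mu>_closed: "k \<ge> 1 \<Longrightarrow> xs \<in> tuples k T \<Longrightarrow> \<mu> k xs \<in> T"
  using \<mu>_2(1) \<mu>_top_closed \<mu>_other T_0 by (metis tuples_2E)

lemma \<mu>_top_multilinear: "\<mu> (n + 1) \<in> multilinear_maps (gscale scale) (n + 1) T T"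
proof -
  have "\<mu> (n + 1) \<in> tuples (n + 1) T \<rightarrow>\<^sub>E T"
    using \<mu>_top_closed by (auto simp: PiE_def) (auto simp: glued_ops_def Let_def extensional_def)
  moreover have "\<mu> (n + 1) (xs[i := x + y]) = \<mu> (n + 1) (xs[i := x]) + \<mu> (n + 1) (xs[i := y])"
    if "xs \<in> tuples (n + 1) T" "i < n + 1" "x \<in> T" "y \<in> T" for xs i x y
  proof -
    have "x + y \<in> T" using that g.subspace_add[OF subspace_T] by blast
    with that show ?thesis
      by (simp add: \<mu>_top tuples_update map_update lookup_add
          multilinear_add[OF \<theta>_multilinear] map_component_tuples T_components single_add
          del: One_nat_def add_Suc_right)
  qed
  moreover have "\<mu> (n + 1) (xs[i := gscale scale a x]) = gscale scale a (\<mu> (n + 1) (xs[i := x]))"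
    if "xs \<in> tuples (n + 1) T" "i < n + 1" "x \<in> T" for xs i x a
  proof -
    have "gscale scale a x \<in> T" using that g.subspace_scale[OF subspace_T] by blast
    with that show ?thesis
      by (simp add: \<mu>_top tuples_update map_update lookup_simps
          multilinear_scale[OF \<theta>_multilinear] map_component_tuples T_components
          gscale_single[OF vs] del: One_nat_def add_Suc_right)
  qed
  ultimately show ?thesis by (auto simp: multilinear_maps_def simp del: One_nat_def add_Suc_right)
qed

lemma \<mu>_2_multilinear: "\<mu> 2 \<in> multilinear_maps (gscale scale) 2 T T"
proof -
  note sub = g.subspace_add[OF subspace_T] g.subspace_scale[OF subspace_T]
  note simps = \<mu>_2 sub lookup_simps op_add op_scale T_components
  show ?thesis
  proof (rule multilinear_2I)
    show "\<mu> 2 \<in> extensional (tuples 2 T)" by (simp add: glued_ops_def Let_def)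
  next
    show "\<mu> 2 [x, y] \<in> T" if "x \<in> T" "y \<in> T" for x y using \<mu>_2 that by blast
  next
    show "\<mu> 2 [x + x', y] = \<mu> 2 [x, y] + \<mu> 2 [x', y]" if "x \<in> T" "x' \<in> T" "y \<in> T" for x x' y
      by (rule T_eqI) (use that in \<open>simp_all add: simps\<close>)
  next
    show "\<mu> 2 [x, y + y'] = \<mu> 2 [x, y] + \<mu> 2 [x, y']" if "x \<in> T" "y \<in> T" "y' \<in> T" for x y y'
      by (rule T_eqI) (use that in \<open>simp_all add: simps\<close>)
  next
    show "\<mu> 2 [gscale scale a x, y] = gscale scale a (\<mu> 2 [x, y])" if "x \<in> T" "y \<in> T" for a x y
      by (rule T_eqI) (use that in \<open>simp_all add: simps scale_right_distrib\<close>)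
  next
    show "\<mu> 2 [x, gscale scale a y] = gscale scale a (\<mu> 2 [x, y])" if "x \<in> T" "y \<in> T" for a x y
      by (rule T_eqI) (use that in \<open>simp_all add: simps scale_right_distrib\<close>)
  qed
qed

lemma \<mu>_multilinear: "\<mu> \<in> (\<Pi>\<^sub>E k\<in>{1..}. multilinear_maps (gscale scale) k T T)"
proof -
  have "\<mu> k \<in> multilinear_maps (gscale scale) k T T" if "k \<ge> 1" for k
  proof (cases "k = 2 \<or> k = n + 1")
    case True
    then show ?thesis using \<mu>_2_multilinear \<mu>_top_multilinear by blast
  next
    case False
    note sub = g.subspace_add[OF subspace_T] g.subspace_scale[OF subspace_T]
    have "\<mu> k \<in> tuples k T \<rightarrow>\<^sub>E T"
      using \<mu>_closed that by (auto simp: PiE_def) (auto simp: glued_ops_def Let_def extensional_def)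
    then show ?thesis
      using False that by (simp add: multilinear_maps_def \<mu>_other tuples_update sub)
  qed
  then show ?thesis by (auto simp: PiE_def glued_ops_def Let_def)
qed

text \<open>
  The degree formula holds by construction: a product \<open>\<mu> 2 [x, y]\<close> has no component from
  \<open>M \<times> M\<close>, which would have degree \<open>2 t\<close>, and \<open>\<mu> (n + 1)\<close> raises the degree by exactly \<open>t\<close>.
\<close>

lemma \<mu>_degree:
  assumes k: "k \<ge> 1" and len: "length ds = k" and as: "list_all2 (\<lambda>d a. a \<in> homog G d) ds as"
  shows "\<mu> k as \<in> homog G (sum_list ds + int k - 2)"
proof -
  have T: "as \<in> tuples k T"
    by (rule list_all2_homog_tuples[of G, OF G_zero as len])
  consider "k = 2" | "k = n + 1" | "k \<noteq> 2" "k \<noteq> n + 1" by blast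
  then show ?thesis
  proof cases
    case 1
    obtain x y where xy: "as = [x, y]" "x \<in> T" "y \<in> T"
      using T unfolding 1 by (rule tuples_2E)
    with as obtain d d' where ds: "ds = [d, d']" "x \<in> homog G d" "y \<in> homog G d'"
      by (auto simp: list_all2_Cons2)
    note comp = T_components[OF xy(2)] T_components[OF xy(3)]
    have x: "d \<noteq> 0 \<Longrightarrow> c 0 x = 0" "d \<noteq> t \<Longrightarrow> c t x = 0"
      and y: "d' \<noteq> 0 \<Longrightarrow> c 0 y = 0" "d' \<noteq> t \<Longrightarrow> c t y = 0"
      using ds(2,3) unfolding homog_G_iff by simp_all
    have "m (c 0 x) (c 0 y) = 0" if "d + d' \<noteq> 0"
      using that x(1) y(1) op_zero(1)[OF comp(3)] op_zero(2)[OF comp(1)] by (cases "d = 0") auto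
    moreover have "lact (c 0 x) (c t y) = 0" if "d + d' \<noteq> t"
      using that x(1) y(2) op_zero(3)[OF comp(4)] op_zero(4)[OF comp(1)] by (cases "d = 0") auto
    moreover have "ract (c t x) (c 0 y) = 0" if "d + d' \<noteq> t"
      using that x(2) y(1) op_zero(5)[OF comp(3)] op_zero(6)[OF comp(2)] by (cases "d = t") auto
    ultimately show ?thesis
      using \<mu>_2[OF xy(2,3)] by (simp add: homog_G_iff xy(1) ds(1) 1)
  next
    case 2
    have "\<theta> (map (c 0) as) = 0" if nonzero: "sum_list ds \<noteq> 0"
    proof -
      obtain d where "d \<in> set ds" "d \<noteq> 0"
        using nonzero sum_list_eq_zeroI[of ds] by blast
      then obtain i where i: "i < k" "ds ! i \<noteq> 0"
        using len unfolding in_set_conv_nth by auto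
      then have "as ! i \<in> homog G (ds ! i)" using as len by (simp add: list_all2_conv_all_nth)
      then have "c 0 (as ! i) = 0" using i unfolding homog_G_iff by blast
      then have "map (c 0) as ! i = 0" using i tuples_length[OF T] by simp
      then show ?thesis
        using map_component_tuples[OF T] i unfolding 2 by (intro \<theta>_zero)
    qed
    moreover have "\<mu> k as = e t (\<theta> (map (c 0) as))" "\<mu> k as \<in> T"
      using \<mu>_top \<mu>_top_closed T unfolding 2 by blast+
    moreover have "sum_list ds + int k - 2 = sum_list ds + t" using 2 by simp
    ultimately show ?thesis
      unfolding homog_G_iff by (simp add: components_single)
  next
    case 3
    have "\<mu> k as = 0" by (rule \<mu>_other[OF k 3 T])
    then show ?thesis using T_0 unfolding homog_G_iff by simp
  qed
qed

lemma associated_glued: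
  "associated_tuple n (G, \<mu>, \<alpha>', \<beta>') = ((A, m, \<alpha>, \<beta>), (M, lact, ract, \<alpha>\<^sub>M, \<beta>\<^sub>M), \<theta>)"
proof -
  have "(\<lambda>a\<in>A. \<lambda>b\<in>A. c 0 (\<mu> 2 [e 0 a, e 0 b])) = m"
    using m_bilinear
    by (auto simp: bilinear_maps_def PiE_def extensional_def fun_eq_iff \<mu>_2 single_T components_single Pi_iff)
  moreover have "(\<lambda>a\<in>A. \<lambda>x\<in>M. c t (\<mu> 2 [e 0 a, e t x])) = lact"
    using lact_bilinear
    by (auto simp: bilinear_maps_def PiE_def extensional_def fun_eq_iff \<mu>_2 single_T components_single op_zero A_zero M_zero Pi_iff)
  moreover have "(\<lambda>x\<in>M. \<lambda>a\<in>A. c t (\<mu> 2 [e t x, e 0 a])) = ract"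
    using ract_bilinear
    by (auto simp: bilinear_maps_def PiE_def extensional_def fun_eq_iff \<mu>_2 single_T components_single op_zero A_zero M_zero Pi_iff)
  moreover have "(\<lambda>a\<in>A. c 0 (glued_map n A M f g (e 0 a))) = f" if "f \<in> linear_maps scale A A" for f g
    using that
    by (auto simp: linear_maps_def PiE_def extensional_def fun_eq_iff glued_map_components single_T components_single)
  moreover have "(\<lambda>a\<in>M. c t (glued_map n A M f g (e t a))) = g" if "g \<in> linear_maps scale M M" for f g
    using that
    by (auto simp: linear_maps_def PiE_def extensional_def fun_eq_iff glued_map_components single_T components_single)
  moreover have "(\<lambda>as\<in>tuples (n + 1) A. c t (\<mu> (n + 1) (map (e 0) as))) = \<theta>"
  proof -
    have "c t (\<mu> (n + 1) (map (e 0) as)) = \<theta> as" if "as \<in> tuples (n + 1) A" for as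
    proof -
      have "map (e 0) as \<in> tuples (n + 1) T" using that single_T by (auto intro: tuples_map)
      then show ?thesis by (simp add: \<mu>_top components_single comp_def del: One_nat_def add_Suc_right)
    qed
    then show ?thesis
      using \<theta>_multilinear
      by (auto simp: multilinear_maps_def PiE_def extensional_def fun_eq_iff simp del: One_nat_def add_Suc_right)
  qed
  ultimately show ?thesis
    using \<alpha>_linear \<beta>_linear \<alpha>\<^sub>M_linear \<beta>\<^sub>M_linear
    by (simp add: G_simps Let_def del: One_nat_def add_Suc_right)
qed

section \<open>The identities of the glued structure\<close>

text \<open>The argument list of the outer operation in the \<open>(i, p)\<close> summand of the defining identity.\<close>

abbreviation insertion :: "nat \<Rightarrow> nat \<Rightarrow> (int \<Rightarrow>\<^sub>0 'v) list \<Rightarrow> (int \<Rightarrow>\<^sub>0 'v) list" where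
  "insertion i p as \<equiv> map (\<alpha>' ^^ (i - 1)) (take (p - 1) as)
     @ [\<mu> i (take i (drop (p - 1) as))] @ map (\<beta>' ^^ (i - 1)) (drop (p - 1 + i) as)"

lemmas \<alpha>'_funpow = glued_map_funpow[OF \<alpha>_linear \<alpha>\<^sub>M_linear]
lemmas \<beta>'_funpow = glued_map_funpow[OF \<beta>_linear \<beta>\<^sub>M_linear]
lemmas \<alpha>'_closed = glued_map_closed[OF \<alpha>_linear \<alpha>\<^sub>M_linear]
lemmas \<beta>'_closed = glued_map_closed[OF \<beta>_linear \<beta>\<^sub>M_linear]

lemma insertion_tuples:
  assumes as: "as \<in> tuples N T" and i: "i \<in> {1..N}" and p: "p \<in> {1..N + 1 - i}"
  shows "take i (drop (p - 1) as) \<in> tuples i T"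
    and "insertion i p as \<in> tuples (N + 1 - i) T"
    and "insertion i p as ! (p - 1) = \<mu> i (take i (drop (p - 1) as))"
proof -
  have len: "length as = N" and set: "set as \<subseteq> T" using as by (auto simp: tuples_def)
  show take: "take i (drop (p - 1) as) \<in> tuples i T"
    using len set i p set_take_subset[of i "drop (p - 1) as"] set_drop_subset[of "p - 1" as]
    by (auto simp: tuples_def)
  have "\<mu> i (take i (drop (p - 1) as)) \<in> T" using \<mu>_closed take i by auto
  moreover have "(\<alpha>' ^^ (i - 1)) x \<in> T" if "x \<in> set (take (p - 1) as)" for x
    using \<alpha>'_funpow(1) set in_set_takeD[OF that] by auto
  moreover have "(\<beta>' ^^ (i - 1)) x \<in> T" if "x \<in> set (drop (p - 1 + i) as)" for x
    using \<beta>'_funpow(1) set in_set_dropD[OF that] by auto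
  ultimately show "insertion i p as \<in> tuples (N + 1 - i) T"
    using len i p by (auto simp: tuples_def)
  show "insertion i p as ! (p - 1) = \<mu> i (take i (drop (p - 1) as))"
  proof -
    have "length (map (\<alpha>' ^^ (i - 1)) (take (p - 1) as)) = p - 1" using len i p by auto
    then show ?thesis by (metis append_Cons nth_append_length)
  qed
qed

text \<open>
  Only the operations \<open>2\<close> and \<open>n + 1\<close> are nonzero, and \<open>\<mu> (n + 1)\<close> cannot be inserted into
  itself because its values lie in \<open>M\<close> while its arguments are taken from \<open>A\<close>. So an inner
  operation \<open>i\<close> contributes only for \<open>N = 3\<close> or \<open>N = n + 2\<close>.
\<close>

lemma insertion_vanishes:
  assumes as: "as \<in> tuples N T" and i: "i \<in> {1..N}" and p: "p \<in> {1..N + 1 - i}"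
    and not: "\<not> (N = 3 \<and> i = 2)" "\<not> (N = n + 2 \<and> (i = 2 \<or> i = n + 1))"
  shows "\<mu> (N + 1 - i) (insertion i p as) = 0"
proof -
  let ?j = "N + 1 - i"
  note ins = insertion_tuples[OF as i p]
  have j: "?j \<ge> 1" "p - 1 < ?j" using i p by auto
  consider "?j \<noteq> 2 \<and> ?j \<noteq> n + 1" | "i \<noteq> 2 \<and> i \<noteq> n + 1" | "i = n + 1" "?j = n + 1"
    using not i by fastforce
  then show ?thesis
  proof cases
    case 1
    then show ?thesis using \<mu>_other[OF j(1) _ _ ins(2)] by blast
  next
    case 2
    then have "insertion i p as ! (p - 1) = 0" using \<mu>_other[OF _ _ _ ins(1)] ins(3) i by simp
    moreover have "\<mu> ?j \<in> multilinear_maps (gscale scale) ?j T T"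
      using \<mu>_multilinear j(1) by (auto simp: PiE_def)
    ultimately show ?thesis
      using multilinear_zero[OF g.vector_space_axioms _ ins(2) j(2)] by blast
  next
    \<comment> \<open>The inserted entry lies in \<open>M\<close>, so its component in \<open>A\<close>, which \<open>\<theta>\<close> reads, is \<open>0\<close>.\<close>
    case 3
    have "insertion i p as ! (p - 1) = e t (\<theta> (map (c 0) (take i (drop (p - 1) as))))"
      using ins(1,3) \<mu>_top unfolding 3(1) by metis
    then have "map (c 0) (insertion i p as) ! (p - 1) = 0"
      using tuples_length[OF ins(2)] j(2) by (simp only: nth_map components_single)
    then have "\<theta> (map (c 0) (insertion i p as)) = 0"
      using \<theta>_zero[of _ "p - 1"] map_component_tuples[OF ins(2)] j(2) unfolding 3(2) by blast
    then show ?thesis using \<mu>_top ins(2) unfolding 3(2) by (metis single_zero)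
  qed
qed

abbreviation "summand ds as N i p \<equiv>
  gscale scale ((-1) powi (int p * (int i + 1) + int i * sum_list (take (p - 1) ds)))
    (\<mu> (N + 1 - i) (insertion i p as))"

text \<open>
  The index set \<open>I\<close> of the inner arities is left free so that the three cases \<open>N = 3\<close>, \<open>N = n + 2\<close> and
  all other \<open>N\<close> can keep exactly the summands that may be nonzero.
\<close>

lemma expr_restrict:
  assumes as: "as \<in> tuples N T" and I: "I \<subseteq> {1..N}"
    and J: "\<And>i. i \<in> {1..N} - I \<Longrightarrow> \<not> (N = 3 \<and> i = 2) \<and> \<not> (N = n + 2 \<and> (i = 2 \<or> i = n + 1))"
  shows "bihom_A_inf_expr scale \<mu> \<alpha>' \<beta>' N ds as = (\<Sum>i\<in>I. \<Sum>p=1..N + 1 - i. summand ds as N i p)"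
  unfolding bihom_A_inf_expr_def
proof (rule sum.mono_neutral_right)
  show "\<forall>i\<in>{1..N} - I. (\<Sum>p=1..N + 1 - i. summand ds as N i p) = 0"
  proof
    fix i assume i: "i \<in> {1..N} - I"
    have "summand ds as N i p = 0" if "p \<in> {1..N + 1 - i}" for p
      using insertion_vanishes[OF as _ that] J[OF i] i by simp
    then show "(\<Sum>p=1..N + 1 - i. summand ds as N i p) = 0" by (intro sum.neutral) blast
  qed
qed (use I in auto)

lemma expr_other:
  assumes "as \<in> tuples N T" "N \<noteq> 3" "N \<noteq> n + 2"
  shows "bihom_A_inf_expr scale \<mu> \<alpha>' \<beta>' N ds as = 0"
  using expr_restrict[of as N "{}"] assms by simp

lemma minus_one_powi: "(-1 :: 'k) powi k = (if even k then 1 else -1)"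
  by (simp add: power_int_minus_left)

lemma expr_3:
  assumes T: "x \<in> T" "y \<in> T" "z \<in> T"
  shows "bihom_A_inf_expr scale \<mu> \<alpha>' \<beta>' 3 ds [x, y, z]
    = \<mu> 2 [\<alpha>' x, \<mu> 2 [y, z]] - \<mu> 2 [\<mu> 2 [x, y], \<beta>' z]"
proof -
  have "[x, y, z] \<in> tuples 3 T" using T by (simp add: tuples_def)
  then have "bihom_A_inf_expr scale \<mu> \<alpha>' \<beta>' 3 ds [x, y, z]
      = (\<Sum>i\<in>{2}. \<Sum>p=1..3 + 1 - i. summand ds [x, y, z] 3 i p)"
    by (rule expr_restrict) (use n_ge_2 in auto)
  also have "\<dots> = (\<Sum>p\<in>{1, 2}. summand ds [x, y, z] 3 2 p)"
  proof -
    have "{1..3 + 1 - 2} = {1, 2 :: nat}" by auto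
    then show ?thesis by (simp only: sum.insert sum.empty finite.emptyI empty_iff not_False_eq_True add_0_right)
  qed
  also have "\<dots> = \<mu> 2 [\<alpha>' x, \<mu> 2 [y, z]] - \<mu> 2 [\<mu> 2 [x, y], \<beta>' z]"
    by (simp add: minus_one_powi numeral_2_eq_2)
  finally show ?thesis .
qed

text \<open>
  For \<open>N = n + 2\<close> the summands with inner operation \<open>2\<close> are the middle terms of the Hochschild
  coboundary of \<open>\<theta>\<close>, and the two with inner operation \<open>n + 1\<close> are its outer terms. The degree
  of the first argument enters one sign only, that of the left action of this argument; if the
  degree is not \<open>0\<close> then the degree \<open>0\<close> component acting there vanishes.
\<close>

lemma expr_top:
  assumes hom: "list_all2 (\<lambda>d a. a \<in> homog G d) ds as" and len: "length ds = n + 2"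
  shows "bihom_A_inf_expr scale \<mu> \<alpha>' \<beta>' (n + 2) ds as
    = e t (hoch_coboundary scale m \<alpha> \<beta> lact ract (n + 1) \<theta> (map (c 0) as))"
proof -
  have as: "as \<in> tuples (n + 2) T"
    by (rule list_all2_homog_tuples[of G, OF G_zero hom len])
  have las: "length as = n + 2" and set: "set as \<subseteq> T" using as by (auto simp: tuples_def)
  define bs where "bs = map (c 0) as"
  have lbs: "length bs = n + 2" and bA: "set bs \<subseteq> A"
    using map_component_tuples[OF as] by (auto simp: bs_def tuples_def)
  let ?S = "\<lambda>i p. summand ds as (n + 2) i p"
  have closed: "?S i p \<in> T" if "i \<in> {1..n + 2}" "p \<in> {1..n + 2 + 1 - i}" for i p
    using \<mu>_closed insertion_tuples(2)[OF as that] that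
    by (intro g.subspace_scale[OF subspace_T]) auto

  have "bihom_A_inf_expr scale \<mu> \<alpha>' \<beta>' (n + 2) ds as
      = (\<Sum>i\<in>{2, n + 1}. \<Sum>p=1..n + 2 + 1 - i. ?S i p)"
    using as by (rule expr_restrict) (use n_ge_2 in auto)
  also have "\<dots> = (\<Sum>p=1..n + 1. ?S 2 p) + (\<Sum>p\<in>{1, 2}. ?S (n + 1) p)"
  proof -
    have "n + 2 + 1 - 2 = n + 1" "n + 2 + 1 - (n + 1) = 2" "2 \<noteq> n + 1" "{1..2} = {1, 2 :: nat}"
      using n_ge_2 by auto
    then show ?thesis by simp
  qed
  finally have expr: "bihom_A_inf_expr scale \<mu> \<alpha>' \<beta>' (n + 2) ds as
      = (\<Sum>p=1..n + 1. ?S 2 p) + (?S (n + 1) 1 + ?S (n + 1) 2)" by simp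

  have nth: "as ! i \<in> T" "bs ! i = c 0 (as ! i)" if "i < n + 2" for i
    using that las set by (auto simp: bs_def)

  \<comment> \<open>Inner operation \<open>2\<close> at position \<open>p\<close>: the exponent \<open>3 p + 2 s\<close> has the parity of \<open>p\<close>.\<close>
  have middle: "?S 2 p = e t (scale ((-1) ^ p) (\<theta> (map \<alpha> (take (p - 1) bs)
      @ [m (bs ! (p - 1)) (bs ! p)] @ map \<beta> (drop (p + 1) bs))))" if p: "p \<in> {1..n + 1}" for p
  proof -
    have i: "2 \<in> {1..n + 2}" and p': "p \<in> {1..n + 2 + 1 - 2}" using p n_ge_2 by auto
    note ins = insertion_tuples[OF as i p']
    have j: "n + 2 + 1 - 2 = n + 1" by simp
    have "drop (p - 1) as = as ! (p - 1) # as ! p # drop (p + 1) as"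
      using p las Cons_nth_drop_Suc[of "p - 1" as] Cons_nth_drop_Suc[of p as] by auto
    then have two: "take 2 (drop (p - 1) as) = [as ! (p - 1), as ! p]" by simp
    have "map (c 0) (insertion 2 p as) = map \<alpha> (take (p - 1) bs)
      @ [m (bs ! (p - 1)) (bs ! p)] @ map \<beta> (drop (p + 1) bs)"
    proof -
      have "map (c 0) (map (\<alpha>' ^^ (2 - 1)) (take (p - 1) as)) = map \<alpha> (take (p - 1) bs)"
        using set in_set_takeD by (fastforce simp: bs_def take_map glued_map_components)
      moreover have "map (c 0) (map (\<beta>' ^^ (2 - 1)) (drop (p - 1 + 2) as)) = map \<beta> (drop (p + 1) bs)"
        using set in_set_dropD p by (fastforce simp: bs_def drop_map glued_map_components)
      moreover have "c 0 (\<mu> 2 (take 2 (drop (p - 1) as))) = m (bs ! (p - 1)) (bs ! p)"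
        unfolding two using p by (subst \<mu>_2) (auto simp: nth)
      ultimately show ?thesis by (simp only: map_append list.map)
    qed
    moreover have "(-1 :: 'k) powi (int p * (int 2 + 1) + int 2 * sum_list (take (p - 1) ds)) = (-1) ^ p"
      by (simp add: minus_one_powi minus_one_power_iff)
    ultimately show ?thesis
      using \<mu>_top ins(2) unfolding j by (metis gscale_single[OF vs])
  qed

  \<comment> \<open>Inner operation \<open>n + 1\<close> in the first slot, applied to the first \<open>n + 1\<close> arguments: the right action.\<close>
  have "?S (n + 1) 1 = gscale scale ((-1) ^ (n + 2))
      (\<mu> 2 [\<mu> (n + 1) (take (n + 1) as), (\<beta>' ^^ n) (as ! (n + 1))])"
  proof -
    have "drop (n + 1) as = [as ! (n + 1)]"
      using las Cons_nth_drop_Suc[of "n + 1" as] by simp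
    moreover have "(-1 :: 'k) powi (int 1 * (int (n + 1) + 1)) = (-1) ^ (n + 2)"
      by (simp add: minus_one_powi minus_one_power_iff)
    ultimately show ?thesis by simp
  qed
  moreover have "take (n + 1) as \<in> tuples (n + 1) T"
    using las set set_take_subset[of "n + 1" as] by (auto simp: tuples_def)
  moreover have "(\<beta>' ^^ n) (as ! (n + 1)) \<in> T" "c 0 ((\<beta>' ^^ n) (as ! (n + 1))) = (\<beta> ^^ n) (bs ! (n + 1))"
    "c t ((\<beta>' ^^ n) (as ! (n + 1))) \<in> M"
    using nth[of "n + 1"] \<beta>'_funpow(1,2)[of "as ! (n + 1)" n] T_components(2) by simp_all
  moreover have "(\<beta> ^^ n) (bs ! (n + 1)) \<in> A"
    using calculation(3,4) T_components(1) by metis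
  ultimately have right: "c t (?S (n + 1) 1)
      = scale ((-1) ^ (n + 2)) (ract (\<theta> (take (n + 1) bs)) ((\<beta> ^^ n) (bs ! (n + 1))))"
    and right0: "c 0 (?S (n + 1) 1) = 0"
    by (simp_all only: \<mu>_2 \<mu>_top_closed lookup_gscale[OF vs]) 
       (simp_all only: \<mu>_top components_single op_zero bs_def take_map add_0 scale_zero_right)

  \<comment> \<open>Inner operation \<open>n + 1\<close> in the second slot: the left action of the first argument.\<close>
  have "?S (n + 1) 2 = gscale scale ((-1) powi (int (n + 1) * ds ! 0))
      (\<mu> 2 [(\<alpha>' ^^ n) (as ! 0), \<mu> (n + 1) (drop 1 as)])"
  proof -
    have "take 1 as = [as ! 0]" "take 1 ds = [ds ! 0]" "drop (n + 2) as = []"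
      "take (n + 1) (drop 1 as) = drop 1 as"
      using las len by (auto simp: take_Suc_conv_app_nth)
    moreover have "(-1 :: 'k) powi (int 2 * (int (n + 1) + 1) + int (n + 1) * ds ! 0)
        = (-1) powi (int (n + 1) * ds ! 0)"
      by (simp add: minus_one_powi)
    ultimately show ?thesis by simp
  qed
  moreover have d1: "drop 1 as \<in> tuples (n + 1) T"
    using las set set_drop_subset[of 1 as] by (auto simp: tuples_def)
  moreover have "(\<alpha>' ^^ n) (as ! 0) \<in> T" "c 0 ((\<alpha>' ^^ n) (as ! 0)) = (\<alpha> ^^ n) (bs ! 0)"
    "c t ((\<alpha>' ^^ n) (as ! 0)) \<in> M"
    using nth[of 0] \<alpha>'_funpow(1,2)[of "as ! 0" n] T_components(2) by simp_all
  moreover have "(\<alpha> ^^ n) (bs ! 0) \<in> A"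
    using calculation(3,4) T_components(1) by metis
  ultimately have "c t (?S (n + 1) 2)
      = scale ((-1) powi (int (n + 1) * ds ! 0)) (lact ((\<alpha> ^^ n) (bs ! 0)) (\<theta> (drop 1 bs)))"
    and left0: "c 0 (?S (n + 1) 2) = 0"
    by (simp_all only: \<mu>_2 \<mu>_top_closed lookup_gscale[OF vs])
       (simp_all only: \<mu>_top components_single op_zero bs_def drop_map add_0_right scale_zero_right)
  moreover have "lact ((\<alpha> ^^ n) (bs ! 0)) (\<theta> (drop 1 bs)) = 0" if "ds ! 0 \<noteq> 0"
  proof -
    have "as ! 0 \<in> homog G (ds ! 0)" by (rule list_all2_nthD[OF hom]) (simp add: len)
    then have "bs ! 0 = 0" using that nth[of 0] unfolding homog_G_iff by simp
    moreover have "(\<alpha> ^^ k) 0 = 0" for k by (induction k) (auto simp: map_zero)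
    ultimately show ?thesis
      using op_zero(3) \<theta>_closed map_component_tuples[OF d1] by (simp add: bs_def drop_map)
  qed
  ultimately have left: "c t (?S (n + 1) 2) = lact ((\<alpha> ^^ n) (bs ! 0)) (\<theta> (drop 1 bs))"
    by (cases "ds ! 0 = 0") simp_all

  have "bihom_A_inf_expr scale \<mu> \<alpha>' \<beta>' (n + 2) ds as \<in> T"
    unfolding expr using n_ge_2
    by (intro g.subspace_add[OF subspace_T] g.subspace_sum[OF subspace_T] closed) auto
  moreover have "c t (bihom_A_inf_expr scale \<mu> \<alpha>' \<beta>' (n + 2) ds as)
    = hoch_coboundary scale m \<alpha> \<beta> lact ract (n + 1) \<theta> bs"
  proof -
    have "c t (\<Sum>p=1..n + 1. ?S 2 p) = (\<Sum>p=1..n + 1. scale ((-1) ^ p) (\<theta> (map \<alpha> (take (p - 1) bs)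
      @ [m (bs ! (p - 1)) (bs ! p)] @ map \<beta> (drop (p + 1) bs))))"
      unfolding lookup_sum by (intro sum.cong refl) (simp only: middle components_single)
    moreover have "n + 1 + 1 = n + 2" "n + 1 - 1 = n" by auto
    ultimately show ?thesis
      unfolding expr hoch_coboundary_def lookup_add right left
      by (simp only: add.assoc add.commute add.left_commute)
  qed
  moreover have "c 0 (bihom_A_inf_expr scale \<mu> \<alpha>' \<beta>' (n + 2) ds as) = 0"
  proof -
    have "c 0 (\<Sum>p=1..n + 1. ?S 2 p) = 0"
      unfolding lookup_sum by (intro sum.neutral ballI) (simp only: middle components_single)
    then show ?thesis unfolding expr lookup_add right0 left0 by simp
  qed
  moreover from calculation(1,2) have "hoch_coboundary scale m \<alpha> \<beta> lact ract (n + 1) \<theta> bs \<in> M"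
    using T_components(2) by metis
  ultimately show ?thesis
    unfolding bs_def[symmetric] by (intro T_eqI single_T) (simp_all only: components_single)
qed

lemma glued_map_commute_iff:
  "(\<forall>x\<in>T. \<alpha>' (\<beta>' x) = \<beta>' (\<alpha>' x)) \<longleftrightarrow>
   (\<forall>a\<in>A. \<alpha> (\<beta> a) = \<beta> (\<alpha> a)) \<and> (\<forall>x\<in>M. \<alpha>\<^sub>M (\<beta>\<^sub>M x) = \<beta>\<^sub>M (\<alpha>\<^sub>M x))" (is "?L \<longleftrightarrow> ?R")
proof
  assume L: ?L
  have "\<alpha> (\<beta> a) = \<beta> (\<alpha> a)" if "a \<in> A" for a
    using arg_cong[OF bspec[OF L single_T(1)[OF that]], of "c 0"] that
    by (simp add: glued_map_components \<alpha>'_closed \<beta>'_closed single_T components_single)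
  moreover have "\<alpha>\<^sub>M (\<beta>\<^sub>M x) = \<beta>\<^sub>M (\<alpha>\<^sub>M x)" if "x \<in> M" for x
    using arg_cong[OF bspec[OF L single_T(2)[OF that]], of "c t"] that
    by (simp add: glued_map_components \<alpha>'_closed \<beta>'_closed single_T components_single)
  ultimately show ?R by blast
next
  assume R: ?R
  show ?L
    by (intro ballI T_eqI)
      (simp_all add: R glued_map_components \<alpha>'_closed \<beta>'_closed T_components)
qed

text \<open>
  Stated for an arbitrary pair \<open>(f, g)\<close> since it is needed for \<open>(\<alpha>, \<alpha>\<^sub>M)\<close> and \<open>(\<beta>, \<beta>\<^sub>M)\<close>. Arity \<open>2\<close>
  gives the first three equations, by the degrees of the two arguments, and arity \<open>n + 1\<close> gives
  the last one.
\<close>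

lemma glued_map_multiplicative_iff:
  assumes f: "f \<in> linear_maps scale A A" and g: "g \<in> linear_maps scale M M"
  shows "(\<forall>k\<ge>1. \<forall>as\<in>tuples k T. glued_map n A M f g (\<mu> k as) = \<mu> k (map (glued_map n A M f g) as))
   \<longleftrightarrow> (\<forall>a\<in>A. \<forall>b\<in>A. f (m a b) = m (f a) (f b))
     \<and> (\<forall>a\<in>A. \<forall>x\<in>M. g (lact a x) = lact (f a) (g x))
     \<and> (\<forall>a\<in>A. \<forall>x\<in>M. g (ract x a) = ract (g x) (f a))
     \<and> (\<forall>as\<in>tuples (n + 1) A. g (\<theta> as) = \<theta> (map f as))" (is "?L \<longleftrightarrow> ?R")
proof -
  let ?F = "glued_map n A M f g"
  note closed = glued_map_closed[OF f g]
  note zero = linear_zero[OF vs f A_zero] linear_zero[OF vs g M_zero]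
  note simps = glued_map_components closed \<mu>_2 op_closed linear_closed[OF f] linear_closed[OF g]
  have component_map: "map (c 0) (map ?F as) = map f (map (c 0) as)" if "as \<in> tuples k T" for as k
    using that by (auto simp: tuples_def glued_map_components)
  show ?thesis
  proof
    assume L: ?L
    have two: "?F (\<mu> 2 [x, y]) = \<mu> 2 [?F x, ?F y]" if "x \<in> T" "y \<in> T" for x y
      using L[rule_format, of 2 "[x, y]"] that by (simp add: tuples_def)
    have "f (m a b) = m (f a) (f b)" if "a \<in> A" "b \<in> A" for a b
      using arg_cong[OF two[OF single_T(1) single_T(1)], of a b "c 0"] that
      by (simp add: simps single_T components_single)
    moreover have "g (lact a x) = lact (f a) (g x)" if "a \<in> A" "x \<in> M" for a x
      using arg_cong[OF two[OF single_T(1) single_T(2)], of a x "c t"] that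
      by (simp add: simps single_T components_single zero op_zero A_zero M_zero)
    moreover have "g (ract x a) = ract (g x) (f a)" if "a \<in> A" "x \<in> M" for a x
      using arg_cong[OF two[OF single_T(2) single_T(1)], of x a "c t"] that
      by (simp add: simps single_T components_single zero op_zero A_zero M_zero)
    moreover have "g (\<theta> as) = \<theta> (map f as)" if as: "as \<in> tuples (n + 1) A" for as
    proof -
      let ?xs = "map (e 0) as"
      have xs: "?xs \<in> tuples (n + 1) T" using as single_T by (auto intro: tuples_map)
      have "map ?F ?xs \<in> tuples (n + 1) T" using xs closed by (rule tuples_map)
      moreover have "map (c 0) ?xs = as" by (simp add: components_single comp_def)
      moreover have "?F (\<mu> (n + 1) ?xs) = \<mu> (n + 1) (map ?F ?xs)" using L xs by simp
      ultimately show ?thesis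
        using glued_map_components(2)[OF \<mu>_top_closed[OF xs], of f g] component_map[OF xs]
        by (simp only: \<mu>_top xs components_single)
    qed
    ultimately show ?R by blast
  next
    assume R: ?R
    show ?L
    proof (intro allI impI ballI)
      fix k as assume k: "1 \<le> k" and as: "as \<in> tuples k T"
      have Fas: "map ?F as \<in> tuples k T" using as closed by (rule tuples_map)
      consider "k = 2" | "k = n + 1" | "k \<noteq> 2" "k \<noteq> n + 1" by blast
      then show "?F (\<mu> k as) = \<mu> k (map ?F as)"
      proof cases
        case 1
        obtain x y where xy: "as = [x, y]" "x \<in> T" "y \<in> T"
          using as unfolding 1 by (rule tuples_2E)
        show ?thesis
          unfolding 1 xy(1) list.map
          by (rule T_eqI) (use R xy(2,3) in \<open>simp_all add: simps T_components linear_add[OF g]\<close>)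
      next
        case 2
        note top = as[unfolded 2] Fas[unfolded 2]
        have "c t (?F (\<mu> (n + 1) as)) = c t (\<mu> (n + 1) (map ?F as))"
          using R map_component_tuples[OF top(1)]
          by (simp only: glued_map_components \<mu>_top_closed top)
             (simp only: \<mu>_top top components_single component_map[OF top(1)])
        moreover have "c 0 (?F (\<mu> (n + 1) as)) = c 0 (\<mu> (n + 1) (map ?F as))"
          by (simp only: glued_map_components \<mu>_top_closed top)
             (simp only: \<mu>_top top components_single zero)
        ultimately show ?thesis
          unfolding 2 by (intro T_eqI closed \<mu>_top_closed top)
      next
        case 3
        have "?F 0 = 0"
          using linear_zero[OF g.vector_space_axioms glued_map_linear[OF f g] T_0] .
        then show ?thesis using \<mu>_other[OF k 3] as Fas by simp
      qed
    qed
  qed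
qed

text \<open>
  The associativity identity decomposes by the position of the argument from \<open>M\<close>: none gives
  associativity of \<open>A\<close>, and the three positions give the three bimodule laws.
\<close>

lemma A_inf_identities_iff:
  "(\<forall>N ds as. N \<ge> 1 \<longrightarrow> length ds = N \<longrightarrow> list_all2 (\<lambda>d a. a \<in> homog G d) ds as \<longrightarrow>
      bihom_A_inf_expr scale \<mu> \<alpha>' \<beta>' N ds as = 0) \<longleftrightarrow>
   (\<forall>a\<in>A. \<forall>b\<in>A. \<forall>d\<in>A. m (\<alpha> a) (m b d) = m (m a b) (\<beta> d)) \<and>
   (\<forall>a\<in>A. \<forall>b\<in>A. \<forall>x\<in>M. lact (\<alpha> a) (lact b x) = lact (m a b) (\<beta>\<^sub>M x)) \<and>
   (\<forall>a\<in>A. \<forall>b\<in>A. \<forall>x\<in>M. ract (\<alpha>\<^sub>M x) (m a b) = ract (ract x a) (\<beta> b)) \<and>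
   (\<forall>a\<in>A. \<forall>b\<in>A. \<forall>x\<in>M. lact (\<alpha> a) (ract x b) = ract (lact a x) (\<beta> b)) \<and>
   (\<forall>as\<in>tuples (n + 2) A. hoch_coboundary scale m \<alpha> \<beta> lact ract (n + 1) \<theta> as = 0)"
  (is "?L \<longleftrightarrow> ?R")
proof -
  note simps = glued_map_components \<alpha>'_closed \<beta>'_closed \<mu>_2 op_closed
    linear_closed[OF \<alpha>_linear] linear_closed[OF \<alpha>\<^sub>M_linear]
    linear_closed[OF \<beta>_linear] linear_closed[OF \<beta>\<^sub>M_linear]
  note single_simps = single_T single_homog components_single map_zero op_zero A_zero M_zero
  show ?thesis
  proof
    assume L: ?L
    have assoc: "\<mu> 2 [\<alpha>' x, \<mu> 2 [y, z]] = \<mu> 2 [\<mu> 2 [x, y], \<beta>' z]"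
      if "x \<in> homog G d1" "y \<in> homog G d2" "z \<in> homog G d3" for x y z d1 d2 d3
    proof -
      have "bihom_A_inf_expr scale \<mu> \<alpha>' \<beta>' 3 [d1, d2, d3] [x, y, z] = 0"
        using that by (intro L[rule_format]) auto
      then show ?thesis using that by (subst (asm) expr_3) (auto simp: homog_G_iff)
    qed
    have "m (\<alpha> a) (m b d) = m (m a b) (\<beta> d)" if "a \<in> A" "b \<in> A" "d \<in> A" for a b d
      using arg_cong[OF assoc[OF single_homog(1) single_homog(1) single_homog(1)], of a b d "c 0"] that
      by (simp add: simps single_simps)
    moreover have "lact (\<alpha> a) (lact b x) = lact (m a b) (\<beta>\<^sub>M x)" if "a \<in> A" "b \<in> A" "x \<in> M" for a b x
      using arg_cong[OF assoc[OF single_homog(1) single_homog(1) single_homog(2)], of a b x "c t"] that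
      by (simp add: simps single_simps)
    moreover have "ract (\<alpha>\<^sub>M x) (m a b) = ract (ract x a) (\<beta> b)" if "a \<in> A" "b \<in> A" "x \<in> M" for a b x
      using arg_cong[OF assoc[OF single_homog(2) single_homog(1) single_homog(1)], of x a b "c t"] that
      by (simp add: simps single_simps)
    moreover have "lact (\<alpha> a) (ract x b) = ract (lact a x) (\<beta> b)" if "a \<in> A" "b \<in> A" "x \<in> M" for a b x
      using arg_cong[OF assoc[OF single_homog(1) single_homog(2) single_homog(1)], of a x b "c t"] that
      by (simp add: simps single_simps)
    moreover have "hoch_coboundary scale m \<alpha> \<beta> lact ract (n + 1) \<theta> as = 0"
      if as: "as \<in> tuples (n + 2) A" for as
    proof -
      let ?xs = "map (e 0) as" and ?ds = "replicate (n + 2) (0 :: int)"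
      have "list_all2 (\<lambda>d a. a \<in> homog G d) ?ds ?xs"
        using as single_homog(1) unfolding tuples_def
        by (auto simp: list_all2_conv_all_nth subset_iff simp del: replicate.simps)
      then have "bihom_A_inf_expr scale \<mu> \<alpha>' \<beta>' (n + 2) ?ds ?xs = 0"
        and "bihom_A_inf_expr scale \<mu> \<alpha>' \<beta>' (n + 2) ?ds ?xs
          = e t (hoch_coboundary scale m \<alpha> \<beta> lact ract (n + 1) \<theta> (map (c 0) ?xs))"
        by (intro L[rule_format] expr_top; simp)+
      moreover have "map (c 0) ?xs = as" by (simp add: components_single comp_def)
      ultimately show ?thesis by (metis components_single(2) lookup_zero)
    qed
    ultimately show ?R by blast
  next
    assume R: ?R
    show ?L
    proof (intro allI impI)
      fix N ds as
      assume N: "1 \<le> N" and len: "length ds = N" and hom: "list_all2 (\<lambda>d a. a \<in> homog G d) ds as"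
      have as: "as \<in> tuples N T" by (rule list_all2_homog_tuples[of G, OF G_zero hom len])
      consider "N = 3" | "N = n + 2" | "N \<noteq> 3" "N \<noteq> n + 2" by blast
      then show "bihom_A_inf_expr scale \<mu> \<alpha>' \<beta>' N ds as = 0"
      proof cases
        case 1
        obtain x y z where xyz: "as = [x, y, z]" and T: "x \<in> T" "y \<in> T" "z \<in> T"
          using as unfolding 1 by (rule tuples_3E)
        have "\<mu> 2 [\<alpha>' x, \<mu> 2 [y, z]] = \<mu> 2 [\<mu> 2 [x, y], \<beta>' z]"
          by (rule T_eqI) (use R T in \<open>simp_all add: simps T_components op_add\<close>)
        then show ?thesis unfolding 1 xyz by (simp add: expr_3 T)
      next
        case 2
        have "map (c 0) as \<in> tuples (n + 2) A" using map_component_tuples as unfolding 2 by blast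
        then show ?thesis
          using R expr_top[OF hom] len unfolding 2 by (simp only: single_zero)
      next
        case 3
        then show ?thesis using expr_other as by blast
      qed
    qed
  qed
qed

text \<open>
  Over linear data only the equations remain of the axioms; they are grouped as in the three
  preceding equivalences.
\<close>

lemma bihom_bimodule_iff:
  "bihom_bimodule scale A m \<alpha> \<beta> M lact ract \<alpha>\<^sub>M \<beta>\<^sub>M \<longleftrightarrow>
   ((\<forall>a\<in>A. \<alpha> (\<beta> a) = \<beta> (\<alpha> a)) \<and> (\<forall>x\<in>M. \<alpha>\<^sub>M (\<beta>\<^sub>M x) = \<beta>\<^sub>M (\<alpha>\<^sub>M x))) \<and>
   ((\<forall>a\<in>A. \<forall>b\<in>A. \<alpha> (m a b) = m (\<alpha> a) (\<alpha> b)) \<and>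
    (\<forall>a\<in>A. \<forall>x\<in>M. \<alpha>\<^sub>M (lact a x) = lact (\<alpha> a) (\<alpha>\<^sub>M x)) \<and>
    (\<forall>a\<in>A. \<forall>x\<in>M. \<alpha>\<^sub>M (ract x a) = ract (\<alpha>\<^sub>M x) (\<alpha> a))) \<and>
   ((\<forall>a\<in>A. \<forall>b\<in>A. \<beta> (m a b) = m (\<beta> a) (\<beta> b)) \<and>
    (\<forall>a\<in>A. \<forall>x\<in>M. \<beta>\<^sub>M (lact a x) = lact (\<beta> a) (\<beta>\<^sub>M x)) \<and>
    (\<forall>a\<in>A. \<forall>x\<in>M. \<beta>\<^sub>M (ract x a) = ract (\<beta>\<^sub>M x) (\<beta> a))) \<and>
   ((\<forall>a\<in>A. \<forall>b\<in>A. \<forall>d\<in>A. m (\<alpha> a) (m b d) = m (m a b) (\<beta> d)) \<and>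
    (\<forall>a\<in>A. \<forall>b\<in>A. \<forall>x\<in>M. lact (\<alpha> a) (lact b x) = lact (m a b) (\<beta>\<^sub>M x)) \<and>
    (\<forall>a\<in>A. \<forall>b\<in>A. \<forall>x\<in>M. ract (\<alpha>\<^sub>M x) (m a b) = ract (ract x a) (\<beta> b)) \<and>
    (\<forall>a\<in>A. \<forall>b\<in>A. \<forall>x\<in>M. lact (\<alpha> a) (ract x b) = ract (lact a x) (\<beta> b)))"
  (is "?L \<longleftrightarrow> ?R")
proof
  assume ?L
  then interpret b: bihom_bimodule scale A m \<alpha> \<beta> M lact ract \<alpha>\<^sub>M \<beta>\<^sub>M .
  show ?R
    by (intro conjI ballI; rule b.\<alpha>_\<beta> b.\<alpha>\<^sub>M_\<beta>\<^sub>M b.\<alpha>_m b.\<beta>_m b.\<alpha>\<^sub>M_lact b.\<beta>\<^sub>M_lact b.\<alpha>\<^sub>M_ract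
      b.\<beta>\<^sub>M_ract b.bihom_assoc b.lact_lact b.ract_ract b.lact_ract; assumption)
next
  assume R: ?R
  show ?L
    by (unfold_locales; (rule subspace_A subspace_M m_bilinear lact_bilinear ract_bilinear
      \<alpha>_linear \<beta>_linear \<alpha>\<^sub>M_linear \<beta>\<^sub>M_linear)?; use R in simp)
qed

lemma glued_iff:
  "bihom_A_inf_algebra scale G \<mu> \<alpha>' \<beta>' \<longleftrightarrow>
   bihom_bimodule scale A m \<alpha> \<beta> M lact ract \<alpha>\<^sub>M \<beta>\<^sub>M \<and>
   \<theta> \<in> hoch_cocycles scale A m \<alpha> \<beta> M lact ract \<alpha>\<^sub>M \<beta>\<^sub>M (n + 1)"
proof -
  have "bihom_A_inf_algebra scale G \<mu> \<alpha>' \<beta>' \<longleftrightarrow>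
      (\<forall>x\<in>T. \<alpha>' (\<beta>' x) = \<beta>' (\<alpha>' x)) \<and>
      (\<forall>k\<ge>1. \<forall>as\<in>tuples k T. \<alpha>' (\<mu> k as) = \<mu> k (map \<alpha>' as)) \<and>
      (\<forall>k\<ge>1. \<forall>as\<in>tuples k T. \<beta>' (\<mu> k as) = \<mu> k (map \<beta>' as)) \<and>
      (\<forall>N ds as. N \<ge> 1 \<longrightarrow> length ds = N \<longrightarrow> list_all2 (\<lambda>d a. a \<in> homog G d) ds as \<longrightarrow>
        bihom_A_inf_expr scale \<mu> \<alpha>' \<beta>' N ds as = 0)" (is "?L \<longleftrightarrow> ?R")
  proof
    assume ?L
    then interpret a: bihom_A_inf_algebra scale G \<mu> \<alpha>' \<beta>' .
    show ?R
      by (intro conjI ballI allI impI; rule a.\<alpha>_\<beta> a.\<alpha>_m a.\<beta>_m a.bihom_A_inf; assumption)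
  next
    assume R: ?R
    show ?L
    proof unfold_locales
      show "\<mu> k as \<in> homog G (sum_list ds + int k - 2)"
        if "1 \<le> k" "length ds = k" "list_all2 (\<lambda>d a. a \<in> homog G d) ds as" for k ds as
        using that by (rule \<mu>_degree)
      show "bihom_A_inf_expr scale \<mu> \<alpha>' \<beta>' N ds as = 0"
        if "1 \<le> N" "length ds = N" "list_all2 (\<lambda>d a. a \<in> homog G d) ds as" for N ds as
        using R that by blast
      show "\<mu> \<in> (\<Pi>\<^sub>E k\<in>{1..}. multilinear_maps (gscale scale) k T T)"
        by (rule \<mu>_multilinear)
    qed (use R in \<open>simp_all add: subspace_G glued_map_linear glued_map_homog
      \<alpha>_linear \<beta>_linear \<alpha>\<^sub>M_linear \<beta>\<^sub>M_linear\<close>)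
  qed
  moreover have "\<theta> \<in> hoch_cocycles scale A m \<alpha> \<beta> M lact ract \<alpha>\<^sub>M \<beta>\<^sub>M (n + 1) \<longleftrightarrow>
      (\<forall>as\<in>tuples (n + 1) A. \<alpha>\<^sub>M (\<theta> as) = \<theta> (map \<alpha> as)) \<and>
      (\<forall>as\<in>tuples (n + 1) A. \<beta>\<^sub>M (\<theta> as) = \<theta> (map \<beta> as)) \<and>
      (\<forall>as\<in>tuples (n + 2) A. hoch_coboundary scale m \<alpha> \<beta> lact ract (n + 1) \<theta> as = 0)"
  proof -
    have "n + 1 + 1 = n + 2" by simp
    then show ?thesis
      unfolding hoch_cocycles_def hoch_cochains_def mem_Collect_eq
      using \<theta>_multilinear by metis
  qed
  ultimately show ?thesis
    unfolding glued_map_commute_iff glued_map_multiplicative_iff[OF \<alpha>_linear \<alpha>\<^sub>M_linear]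
      glued_map_multiplicative_iff[OF \<beta>_linear \<beta>\<^sub>M_linear] A_inf_identities_iff bihom_bimodule_iff
    by argo
qed

end

section \<open>Algebras concentrated in two degrees are glued\<close>

text \<open>
  The abbreviations for components unfold to the entries of \<^const>\<open>associated_tuple\<close>.
\<close>

locale two_ended_algebra = bihom_A_inf_algebra scale G m \<alpha> \<beta>
  for scale :: "'k::field_char_0 \<Rightarrow> 'v::ab_group_add \<Rightarrow> 'v" and G m \<alpha> \<beta> +
  fixes n :: nat
  assumes n_ge_2: "n \<ge> 2" and two_ended: "two_ended_zero_differential n G m"
begin

abbreviation "t \<equiv> int n - 1"
abbreviation "e \<equiv> Poly_Mapping.single :: int \<Rightarrow> 'v \<Rightarrow> _"
abbreviation "c \<equiv> \<lambda>d (x :: int \<Rightarrow>\<^sub>0 'v). Poly_Mapping.lookup x d"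
abbreviation "operation_component d1 d2 d \<equiv> \<lambda>a\<in>G d1. \<lambda>b\<in>G d2. c d (m 2 [e d1 a, e d2 b])"
abbreviation "map_component d f \<equiv> \<lambda>a\<in>G d. c d (f (e d a))"
abbreviation "cocycle \<equiv> \<lambda>as\<in>tuples (n + 1) (G 0). c t (m (n + 1) (map (e 0) as))"

lemma vs: "vector_space scale"
  by unfold_locales

lemma G_zero: "0 \<in> G i"
  using subspace_0[OF subspace_G] .

lemma G_trivial: "i \<noteq> 0 \<Longrightarrow> i \<noteq> t \<Longrightarrow> G i = {0}"
  using two_ended by (simp add: two_ended_zero_differential_def)

lemma single_total: "a \<in> G d \<Longrightarrow> e d a \<in> total G"
  by (rule single_in_total[OF G_zero])

lemma m_multilinear_k: "k \<ge> 1 \<Longrightarrow> m k \<in> multilinear_maps (gscale scale) k (total G) (total G)"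
  using m_multilinear by (auto simp: PiE_def)

lemma operation_component_bilinear:
  "operation_component d1 d2 d \<in> bilinear_maps scale (G d1) (G d2) (G d)"
proof -
  note ml = m_multilinear_k[of 2, simplified]
  have tup: "[e d1 a, e d2 b] \<in> tuples 2 (total G)" if "a \<in> G d1" "b \<in> G d2" for a b
    using that by (simp add: tuples_def single_total)
  have closed: "c d (m 2 [e d1 a, e d2 b]) \<in> G d" if "a \<in> G d1" "b \<in> G d2" for a b
    using total_component[OF multilinear_closed[OF ml tup[OF that]]] .
  have add1: "m 2 [e d1 (a + a'), e d2 b] = m 2 [e d1 a, e d2 b] + m 2 [e d1 a', e d2 b]"
    if "a \<in> G d1" "a' \<in> G d1" "b \<in> G d2" for a a' b
    using multilinear_add[OF ml tup, of a b 0 "e d1 a" "e d1 a'"] that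
    by (simp add: single_total single_add)
  have add2: "m 2 [e d1 a, e d2 (b + b')] = m 2 [e d1 a, e d2 b] + m 2 [e d1 a, e d2 b']"
    if "a \<in> G d1" "b \<in> G d2" "b' \<in> G d2" for a b b'
    using multilinear_add[OF ml tup, of a b 1 "e d2 b" "e d2 b'"] that
    by (simp add: single_total single_add)
  have scale1: "m 2 [e d1 (scale r a), e d2 b] = gscale scale r (m 2 [e d1 a, e d2 b])"
    if "a \<in> G d1" "b \<in> G d2" for a b r
    using multilinear_scale[OF ml tup, of a b 0 "e d1 a" r] that
    by (simp add: single_total gscale_single[OF vs])
  have scale2: "m 2 [e d1 a, e d2 (scale r b)] = gscale scale r (m 2 [e d1 a, e d2 b])"
    if "a \<in> G d1" "b \<in> G d2" for a b r
    using multilinear_scale[OF ml tup, of a b 1 "e d2 b" r] that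
    by (simp add: single_total gscale_single[OF vs])
  show ?thesis
    unfolding bilinear_maps_def
    by (auto simp: closed add1 add2 scale1 scale2 lookup_add lookup_gscale[OF vs]
        subspace_add[OF subspace_G] subspace_scale[OF subspace_G])
qed

lemma map_component_linear:
  assumes f: "f \<in> linear_maps (gscale scale) (total G) (total G)"
  shows "map_component d f \<in> linear_maps scale (G d) (G d)"
proof -
  have "f (e d (scale r a)) = gscale scale r (f (e d a))" if "a \<in> G d" for r a
    using linear_scale[OF f single_total[OF that], of r] by (simp add: gscale_single[OF vs])
  then show ?thesis
    unfolding linear_maps_def
    by (auto simp: single_add linear_add[OF f] single_total lookup_add lookup_gscale[OF vs]
        subspace_add[OF subspace_G] subspace_scale[OF subspace_G]
        intro!: total_component linear_closed[OF f])
qed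

lemma cocycle_multilinear: "cocycle \<in> multilinear_maps scale (n + 1) (G 0) (G t)"
proof -
  note ml = m_multilinear_k[of "n + 1", OF le_add2]
  have tup: "map (e 0) as \<in> tuples (n + 1) (total G)" if "as \<in> tuples (n + 1) (G 0)" for as
    using that single_total by (rule tuples_map)
  have "cocycle \<in> tuples (n + 1) (G 0) \<rightarrow>\<^sub>E G t"
    using total_component[OF multilinear_closed[OF ml tup]] by simp
  moreover have "cocycle (as[i := x + y]) = cocycle (as[i := x]) + cocycle (as[i := y])"
    if as: "as \<in> tuples (n + 1) (G 0)" and i: "i < n + 1" and xy: "x \<in> G 0" "y \<in> G 0" for as i x y
    using multilinear_add[OF ml tup[OF as] i single_total[OF xy(1)] single_total[OF xy(2)]]
    by (simp add: as xy tuples_update subspace_add[OF subspace_G] map_update single_add lookup_add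
        del: One_nat_def add_Suc_right)
  moreover have "cocycle (as[i := scale r x]) = scale r (cocycle (as[i := x]))"
    if as: "as \<in> tuples (n + 1) (G 0)" and i: "i < n + 1" and x: "x \<in> G 0" for as i x r
    using multilinear_scale[OF ml tup[OF as] i single_total[OF x], of r]
    by (simp add: as x tuples_update subspace_scale[OF subspace_G] map_update gscale_single[OF vs]
        lookup_gscale[OF vs] del: One_nat_def add_Suc_right)
  ultimately show ?thesis
    unfolding multilinear_maps_def by blast
qed

sublocale d: gluing_data scale n "G 0" "operation_component 0 0 0" "map_component 0 \<alpha>" "map_component 0 \<beta>"
  "G t" "operation_component 0 t t" "operation_component t 0 t" "map_component t \<alpha>" "map_component t \<beta>"
  cocycle
  by unfold_locales
    (fact n_ge_2 subspace_G operation_component_bilinear cocycle_multilinear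
      map_component_linear[OF \<alpha>_linear] map_component_linear[OF \<beta>_linear])+

lemma glued_space: "two_ended_space n (G 0) (G t) = G"
  using G_trivial by (auto simp: two_ended_space_def fun_eq_iff)

text \<open>
  A linear map of degree \<open>0\<close> cannot mix the two pieces, so it is the sum of its two diagonal
  components.
\<close>

lemma glued_map_components:
  assumes f: "f \<in> linear_maps (gscale scale) (total G) (total G)"
    and deg: "\<And>d a. a \<in> homog G d \<Longrightarrow> f a \<in> homog G d"
  shows "glued_map n (G 0) (G t) (map_component 0 f) (map_component t f) = f"
proof
  fix x
  show "glued_map n (G 0) (G t) (map_component 0 f) (map_component t f) x = f x"
  proof (cases "x \<in> total G")
    case True
    have x: "c d x \<in> G d" for d using True by (rule total_component)
    have f_single: "f (e d (c d x)) = e d (c d (f (e d (c d x))))" for d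
    proof -
      have "f (e d (c d x)) \<in> homog G d" using x by (intro deg) (simp add: homog_def)
      then show ?thesis by (auto simp: homog_def)
    qed
    have "x = e 0 (c 0 x) + e t (c t x)"
      using True x by (intro d.T_eqI d.sum_T) (simp_all add: glued_space d.components_sum)
    then have "f x = f (e 0 (c 0 x)) + f (e t (c t x))"
      using linear_add[OF f single_total[OF x] single_total[OF x], of 0 t] by simp
    also have "\<dots> = glued_map n (G 0) (G t) (map_component 0 f) (map_component t f) x"
      using True x f_single by (simp add: glued_map_def glued_space)
    finally show ?thesis by simp
  next
    case False
    then show ?thesis
      using f by (auto simp: glued_map_def glued_space linear_maps_def)
  qed
qed

text \<open>
  Both families are multilinear and satisfy the same degree formula, so it suffices to compare them
  on homogeneous lists, where a value in a degree other than \<open>0\<close> and \<open>t\<close> is \<open>0\<close> on both sides. In the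
  remaining degrees the components were read off from the operations.
\<close>

lemma glued_ops_components:
  "glued_ops n (G 0) (G t) (operation_component 0 0 0) (operation_component 0 t t)
     (operation_component t 0 t) cocycle = m"
proof
  fix k
  show "d.\<mu> k = m k"
  proof (cases "k \<ge> 1")
    case False
    then have "m k = undefined" using m_multilinear by (intro PiE_arb[OF m_multilinear]) simp
    moreover have "d.\<mu> k = undefined" using False by (simp add: glued_ops_def Let_def)
    ultimately show ?thesis by simp
  next
    case k: True
    note ml = m_multilinear_k[OF k]
    have dml: "d.\<mu> k \<in> multilinear_maps (gscale scale) k (total G) (total G)"
      using d.\<mu>_multilinear k unfolding glued_space by (auto simp: PiE_def)
    have hom_eq: "d.\<mu> k xs = m k xs"
      if len: "length ds = k" and ds: "set ds \<subseteq> {0, t}"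
        and hom: "list_all2 (\<lambda>d a. a \<in> homog G d) ds xs" for ds xs
    proof -
      let ?D = "sum_list ds + int k - 2"
      have degree: "d.\<mu> k xs \<in> homog G ?D" "m k xs \<in> homog G ?D"
        using d.\<mu>_degree[OF k len, unfolded glued_space, OF hom] m_degree[OF k len hom] .
      have trivial: ?thesis if "?D \<noteq> 0" "?D \<noteq> t"
        using homog_trivial[OF G_trivial[OF that] degree(1)] homog_trivial[OF G_trivial[OF that] degree(2)]
        by simp
      have eqI: ?thesis if "?D = d" "c d (d.\<mu> k xs) = c d (m k xs)" for d
        using degree that unfolding homog_def by fastforce
      have xs: "xs \<in> tuples k (total G)"
        by (rule list_all2_homog_tuples[OF G_zero hom len])
      consider "k = 1" | "k = 2" | "k \<ge> 3" using k by linarith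
      then show ?thesis
      proof cases
        case 1
        then obtain x where "xs = [x]" "x \<in> total G"
          using xs by (auto simp: tuples_def length_Suc_conv)
        moreover have "d.\<mu> k xs = 0"
          using 1 xs n_ge_2 by (intro d.\<mu>_other) (auto simp: glued_space)
        ultimately show ?thesis
          using two_ended 1 by (simp add: two_ended_zero_differential_def)
      next
        case 2
        then obtain d1 d2 where ds': "ds = [d1, d2]" "d1 \<in> {0, t}" "d2 \<in> {0, t}"
          using ds len by (auto simp: length_Suc_conv numeral_2_eq_2)
        then obtain a b where ab: "xs = [e d1 a, e d2 b]" "a \<in> G d1" "b \<in> G d2"
          using hom by (auto simp: list_all2_Cons1 homog_def)
        have D: "?D = d1 + d2" using 2 ds' by simp
        have T: "e d1 a \<in> d.T" "e d2 b \<in> d.T" using ab single_total by (simp_all add: glued_space)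
        note \<mu>_2 = d.\<mu>_2(2,3)[OF T]
        consider "d1 = 0" "d2 = 0" | "d1 = 0" "d2 = t" | "d1 = t" "d2 = 0" | "d1 = t" "d2 = t"
          using ds' by blast
        then show ?thesis
        proof cases
          case c: 1
          show ?thesis
            by (rule eqI[of 0]) (use D c ab \<mu>_2 in \<open>simp_all add: 2 d.components_single\<close>)
        next
          case c: 2
          show ?thesis
            by (rule eqI[of t])
              (use D c ab \<mu>_2 in \<open>simp_all add: 2 d.components_single d.op_zero G_zero del: restrict_apply\<close>,
               simp add: c)
        next
          case c: 3
          show ?thesis
            by (rule eqI[of t])
              (use D c ab \<mu>_2 in \<open>simp_all add: 2 d.components_single d.op_zero G_zero del: restrict_apply\<close>,
               simp add: c)
        next
          case c: 4
          then show ?thesis using D d.t_pos by (intro trivial) auto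
        qed
      next
        case k3: 3
        note sums = sum_list_two_values[OF ds]
        show ?thesis
        proof (cases "t \<in> set ds \<or> k \<noteq> n + 1")
          case True
          have "?D \<noteq> t"
          proof (cases "t \<in> set ds")
            case True
            then show ?thesis using sums(2) k3 d.t_pos by auto
          next
            case False
            then have "\<forall>d\<in>set ds. d = 0" using ds by auto
            then have "sum_list ds = 0" by (rule sum_list_eq_zeroI)
            then show ?thesis using True \<open>t \<notin> set ds\<close> by auto
          qed
          moreover have "?D \<noteq> 0" using sums(1) k3 d.t_pos by auto
          ultimately show ?thesis by (intro trivial)
        next
          case False
          then have kn: "k = n + 1" and ds0: "\<forall>d\<in>set ds. d = 0" using ds by auto
          have "sum_list ds = 0" using ds0 by (rule sum_list_eq_zeroI)
          then have D: "?D = t" using kn by simp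
          have entry: "x \<in> homog G 0" if x: "x \<in> set xs" for x
          proof -
            obtain i where "i < length xs" "x = xs ! i" using x by (auto simp: in_set_conv_nth)
            then show ?thesis
              using list_all2_nthD2[OF hom] list_all2_lengthD[OF hom] ds0 by (metis nth_mem)
          qed
          have map_map: "map (e 0) (map (c 0) xs) = xs"
            by (rule nth_equalityI) (use entry in \<open>force simp: homog_def set_conv_nth\<close>)+
          have A: "map (c 0) xs \<in> tuples (n + 1) (G 0)"
            using xs total_component unfolding kn by (rule tuples_map)
          have "d.\<mu> (n + 1) xs = e t (cocycle (map (c 0) xs))"
            using xs unfolding kn by (intro d.\<mu>_top) (simp only: glued_space)
          then have "c t (d.\<mu> (n + 1) xs) = c t (m (n + 1) xs)"
            by (simp only: d.components_single restrict_apply A if_True map_map)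
          then show ?thesis using D kn by (intro eqI) auto
        qed
      qed
    qed
    show ?thesis
    proof
      fix xs
      show "d.\<mu> k xs = m k xs"
      proof (cases "xs \<in> tuples k (total G)")
        case True
        show ?thesis
          by (rule multilinear_eq_on_homog[OF dml ml G_zero G_trivial d.t_pos(3) hom_eq True])
      next
        case False
        have undef: "f xs = undefined" if "f \<in> multilinear_maps (gscale scale) k (total G) (total G)" for f
          using that False by (auto simp: multilinear_maps_def)
        show ?thesis by (rule trans[OF undef[OF dml] undef[OF ml, symmetric]])
      qed
    qed
  qed
qed

end

section \<open>The correspondence\<close>

fun glue ::
  "nat \<Rightarrow> ('v::ab_group_add set \<times> ('v \<Rightarrow> 'v \<Rightarrow> 'v) \<times> ('v \<Rightarrow> 'v) \<times> ('v \<Rightarrow> 'v)) \<times>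
     ('v set \<times> ('v \<Rightarrow> 'v \<Rightarrow> 'v) \<times> ('v \<Rightarrow> 'v \<Rightarrow> 'v) \<times> ('v \<Rightarrow> 'v) \<times> ('v \<Rightarrow> 'v)) \<times> ('v list \<Rightarrow> 'v) \<Rightarrow>
   (int \<Rightarrow> 'v set) \<times> (nat \<Rightarrow> (int \<Rightarrow>\<^sub>0 'v) list \<Rightarrow> (int \<Rightarrow>\<^sub>0 'v)) \<times>
     ((int \<Rightarrow>\<^sub>0 'v) \<Rightarrow> (int \<Rightarrow>\<^sub>0 'v)) \<times> ((int \<Rightarrow>\<^sub>0 'v) \<Rightarrow> (int \<Rightarrow>\<^sub>0 'v))" where
  "glue n ((A, m, \<alpha>, \<beta>), (M, lact, ract, \<alpha>\<^sub>M, \<beta>\<^sub>M), \<theta>) =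
     (two_ended_space n A M, glued_ops n A M m lact ract \<theta>,
      glued_map n A M \<alpha> \<alpha>\<^sub>M, glued_map n A M \<beta> \<beta>\<^sub>M)"

lemma (in gluing_data) glued_two_ended: "n_term n G" "two_ended_zero_differential n G \<mu>"
proof -
  show "n_term n G" using n_ge_2 by (auto simp: n_term_def two_ended_space_def)
  have "\<mu> 1 [x] = 0" if "x \<in> T" for x
    using that n_ge_2 by (intro \<mu>_other) (auto simp: tuples_def)
  then show "two_ended_zero_differential n G \<mu>"
    by (auto simp: two_ended_zero_differential_def two_ended_space_def)
qed

lemma gluing_dataI:
  assumes "n \<ge> 2" and "bihom_bimodule scale A m \<alpha> \<beta> M lact ract \<alpha>\<^sub>M \<beta>\<^sub>M"
    and "\<theta> \<in> hoch_cocycles scale A m \<alpha> \<beta> M lact ract \<alpha>\<^sub>M \<beta>\<^sub>M (n + 1)"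
  shows "gluing_data scale n A m \<alpha> \<beta> M lact ract \<alpha>\<^sub>M \<beta>\<^sub>M \<theta>"
proof -
  interpret bihom_bimodule scale A m \<alpha> \<beta> M lact ract \<alpha>\<^sub>M \<beta>\<^sub>M by fact
  have \<theta>: "\<theta> \<in> multilinear_maps scale (n + 1) A M"
    using assms(3) unfolding hoch_cocycles_def hoch_cochains_def by blast
  show ?thesis
    by unfold_locales (fact assms(1) subspace_A subspace_M m_bilinear lact_bilinear ract_bilinear
      \<alpha>_linear \<beta>_linear \<alpha>\<^sub>M_linear \<beta>\<^sub>M_linear \<theta>)+
qed

lemma (in two_ended_algebra) glue_associated: "glue n (associated_tuple n (G, m, \<alpha>, \<beta>)) = (G, m, \<alpha>, \<beta>)"
  using glued_space glued_ops_components glued_map_components[OF \<alpha>_linear \<alpha>_degree]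
    glued_map_components[OF \<beta>_linear \<beta>_degree]
  by (simp add: Let_def)

theorem theorem6p4:
  fixes scale :: "'k::field_char_0 \<Rightarrow> 'v::ab_group_add \<Rightarrow> 'v" and n :: nat
  assumes "vector_space scale" and "n \<ge> 2"
  shows "bij_betw (associated_tuple n)
    {(G, m, \<alpha>, \<beta>). bihom_A_inf_algebra scale G m \<alpha> \<beta> \<and>
       n_term n G \<and> two_ended_zero_differential n G m}
    {((A, m, \<alpha>, \<beta>), (M, lact, ract, \<alpha>\<^sub>M, \<beta>\<^sub>M), \<theta>).
       bihom_associative_algebra scale A m \<alpha> \<beta> \<and>
       bihom_bimodule scale A m \<alpha> \<beta> M lact ract \<alpha>\<^sub>M \<beta>\<^sub>M \<and>
       \<theta> \<in> hoch_cocycles scale A m \<alpha> \<beta> M lact ract \<alpha>\<^sub>M \<beta>\<^sub>M (n + 1)}"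
    (is "bij_betw _ ?S ?R")
proof (rule bij_betw_byWitness[where f' = "glue n"])
  have algebra: "two_ended_algebra scale G m \<alpha> \<beta> n" if "(G, m, \<alpha>, \<beta>) \<in> ?S" for G m \<alpha> \<beta>
    using that \<open>n \<ge> 2\<close> by (simp add: two_ended_algebra_def two_ended_algebra_axioms_def)
  show "\<forall>x\<in>?S. glue n (associated_tuple n x) = x"
    using two_ended_algebra.glue_associated[OF algebra] by (auto simp del: associated_tuple.simps)
  show "\<forall>y\<in>?R. associated_tuple n (glue n y) = y"
    using gluing_data.associated_glued[OF gluing_dataI[OF \<open>n \<ge> 2\<close>]]
    by (auto simp del: associated_tuple.simps)
  show "associated_tuple n ` ?S \<subseteq> ?R"
  proof (rule image_subsetI)
    fix x assume "x \<in> ?S"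
    obtain G m \<alpha> \<beta> where x: "x = (G, m, \<alpha>, \<beta>)" by (rule prod_cases4)
    interpret two_ended_algebra scale G m \<alpha> \<beta> n using \<open>x \<in> ?S\<close> unfolding x by (rule algebra)
    have "bihom_A_inf_algebra scale G m \<alpha> \<beta>" by unfold_locales
    then have bimodule: "bihom_bimodule scale (G 0) (operation_component 0 0 0) (map_component 0 \<alpha>)
        (map_component 0 \<beta>) (G t) (operation_component 0 t t) (operation_component t 0 t)
        (map_component t \<alpha>) (map_component t \<beta>)"
      and "cocycle \<in> hoch_cocycles scale (G 0) (operation_component 0 0 0) (map_component 0 \<alpha>)
        (map_component 0 \<beta>) (G t) (operation_component 0 t t) (operation_component t 0 t)
        (map_component t \<alpha>) (map_component t \<beta>) (n + 1)"
      using d.glued_iff glued_space glued_ops_components glued_map_components[OF \<alpha>_linear \<alpha>_degree]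
        glued_map_components[OF \<beta>_linear \<beta>_degree] by simp_all
    moreover have "bihom_associative_algebra scale (G 0) (operation_component 0 0 0)
        (map_component 0 \<alpha>) (map_component 0 \<beta>)"
      using bimodule by (simp add: bihom_bimodule_def)
    ultimately show "associated_tuple n x \<in> ?R"
      by (simp add: x Let_def)
  qed
  show "glue n ` ?R \<subseteq> ?S"
  proof (rule image_subsetI)
    fix y assume "y \<in> ?R"
    moreover obtain A m \<alpha> \<beta> M lact ract \<alpha>\<^sub>M \<beta>\<^sub>M \<theta>
      where y: "y = ((A, m, \<alpha>, \<beta>), (M, lact, ract, \<alpha>\<^sub>M, \<beta>\<^sub>M), \<theta>)" by (metis surj_pair)
    ultimately have *: "bihom_bimodule scale A m \<alpha> \<beta> M lact ract \<alpha>\<^sub>M \<beta>\<^sub>M"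
      "\<theta> \<in> hoch_cocycles scale A m \<alpha> \<beta> M lact ract \<alpha>\<^sub>M \<beta>\<^sub>M (n + 1)"
      by simp_all
    interpret gluing_data scale n A m \<alpha> \<beta> M lact ract \<alpha>\<^sub>M \<beta>\<^sub>M \<theta>
      by (rule gluing_dataI[OF \<open>n \<ge> 2\<close> *])
    show "glue n y \<in> ?S"
      using glued_iff glued_two_ended * by (simp add: y)
  qed
qed

end
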